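(* Let $(n,p,k)$ be the type of an LOMSE, i.e. $k$ is a positive even integer and $(n,p)=(15,8)$, $(2l+1,2l)$ or $(4l+3,4l)$ for some positive integer $l$. Let $\lambda=\sqrt{\frac{k(k+n-1)}{p}}$ and $\varphi_0=\sqrt{\frac{p-n\lambda^{-2}}{n-p}}$. If $(n,p,k)=(3,2,2),(5,4,2),(5,4,4)$ or $n\ge7$, then there exists a smooth solution $t\in\mathbb R\mapsto(\varphi(t),\psi(t))$ to the autonomous system $$\begin{cases}\varphi_t=\psi,\\ \psi_t=-\psi-\Big[\big(n-p+\frac{p}{1+\lambda^2\varphi^2}\big)\psi+\big(n-p+\frac{(1-\lambda^2)p}{1+\lambda^2\varphi^2}\big)\varphi\Big]\big[1+(\varphi+\psi)^2\big],\end{cases}$$ with the following properties: - $\lim_{t\to-\infty}(\varphi(t),\psi(t))=(0,0)$; - $\varphi(t)=O(e^{(k-1)t})$ and $\psi(t)=O(e^{(k-1)t})$ as $t\to-\infty$; - $\lim_{t\to+\infty}(\varphi(t),\psi(t))=(\varphi_0,0)$; - $t\mapsto\varphi(t)$ is a strictly increasing function; - $\psi(t)>0$ for every $t\in\mathbb R$.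
   Context: Subscript $t$ denotes $d/dt$. For reference only: an LOMSE of $(n,p,k)$-type is a smooth map $f:S^n\to S^m$, not totally geodesic, such that for some $\theta\in(0,\pi/2)$ the set $\{(\cos\theta\cdot x,\sin\theta\cdot f(x)):x\in S^n\}$ is a minimal submanifold of $S^{n+m+1}$, all nonzero singular values of $f_*$ equal a constant $\lambda$ of constant multiplicity $p$, and whose components are spherical harmonics of degree $k\ge2$. Such maps exist exactly for the triples $(n,p,k)$ listed in the claim. *)

theory Defs
  imports "HOL-Analysis.Analysis" "HOL-Library.Landau_Symbols"
begin

(* The triples (n, p, k) that occur as the type of an LOMSE S^n \<rightarrow> S^m; here k is the degree
   of the spherical harmonics and p the multiplicity of the nonzero singular value. *)
definition lomse_type :: "nat \<Rightarrow> nat \<Rightarrow> nat \<Rightarrow> bool" where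
  "lomse_type n p k \<longleftrightarrow> 0 < k \<and> even k \<and>
     (n = 15 \<and> p = 8 \<or>
      (\<exists>l>0. n = 2 * l + 1 \<and> p = 2 * l) \<or>
      (\<exists>l>0. n = 4 * l + 3 \<and> p = 4 * l))"

definition lomse_lambda :: "nat \<Rightarrow> nat \<Rightarrow> nat \<Rightarrow> real" where
  "lomse_lambda n p k = sqrt (real k * (real k + real n - 1) / real p)"

definition lomse_phi0 :: "nat \<Rightarrow> nat \<Rightarrow> nat \<Rightarrow> real" where
  "lomse_phi0 n p k =
     sqrt ((real p - real n * inverse ((lomse_lambda n p k)\<^sup>2)) / (real n - real p))"

definition smooth_real :: "(real \<Rightarrow> real) \<Rightarrow> bool" where
  "smooth_real f \<longleftrightarrow> (\<forall>m t. (deriv ^^ m) f field_differentiable (at t))"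

definition lomse_field :: "nat \<Rightarrow> nat \<Rightarrow> nat \<Rightarrow> real \<Rightarrow> real \<Rightarrow> real" where
  "lomse_field n p k x y =
     (let L = (lomse_lambda n p k)\<^sup>2 in
      - y - ((real n - real p + real p / (1 + L * x\<^sup>2)) * y +
             (real n - real p + (1 - L) * real p / (1 + L * x\<^sup>2)) * x) * (1 + (x + y)\<^sup>2))"

definition lomse_solution ::
    "nat \<Rightarrow> nat \<Rightarrow> nat \<Rightarrow> (real \<Rightarrow> real) \<Rightarrow> (real \<Rightarrow> real) \<Rightarrow> bool" where
  "lomse_solution n p k \<phi> \<psi> \<longleftrightarrow>
     (\<forall>t. (\<phi> has_real_derivative \<psi> t) (at t) \<and>
          (\<psi> has_real_derivative lomse_field n p k (\<phi> t) (\<psi> t)) (at t))"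

end

theory Submission
  imports Defs
begin

text \<open>
  The origin is a saddle with eigenvalues \<open>k - 1\<close> and \<open>- (n + k)\<close>, and the orbit is its unstable
  manifold. A contraction argument produces the manifold near the origin, and a second one, with a
  much larger exponential weight, continues it to all times for the field truncated outside a box.
  With \<open>w = \<phi>\<^sup>2 / \<phi>\<^sub>0\<^sup>2\<close>, the bracket of the system vanishes on
  \<open>\<psi> = M (1 - w) \<phi> / (1 + M w)\<close>, where \<open>M = (k - 1) (n + k) / n\<close>. Twice this curve is a barrier:
  the orbit starts below it because \<open>k - 1 < 2 M\<close>, and on it the field points downwards, which
  amounts to a polynomial inequality in \<open>M w\<close>, true for the listed types. So \<open>\<psi> > 0\<close> and
  \<open>\<phi> < \<phi>\<^sub>0\<close> for all times. If \<open>\<phi>\<close> stayed away from \<open>\<phi>\<^sub>0\<close>, then \<open>\<psi>' + c \<psi>\<close> would be bounded below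
  by a positive constant and \<open>\<psi> + c \<phi>\<close> would be unbounded.
\<close>

subsection \<open>Bounded solutions of damped systems\<close>

text \<open>Both contractions act on bounded functions on the whole time axis, so existence for all
  times and the behaviour at -\<infinity> come out together. The field grows cubically and must be
  truncated to become Lipschitz, and one contraction cannot do everything: relative to the weight
  exp (2 \<alpha> t) the unstable direction is damped only at rate \<alpha>, which forces a tiny
  box; a heavier weight beats any Lipschitz constant but needs a source that decays as fast at
  -\<infinity>. The orbit in the tiny box supplies one, because its error for the wider truncation
  vanishes identically before some time. The barrier is doubled because the zero curve itself fails:
  on it \<psi>' = - \<psi>, while at its right end the curve has slope - 2 M / (1 + M), less than -
  1 because M > 1, so the curve sinks faster than the orbit. On the doubled curve the bracket is
  positive and pulls \<psi> down; at the right end 4 M / (1 + M) competes with 1 + n / 2, and this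
  decides which types of small dimension are covered.\<close>

lemma has_real_derivative_continuous:
  fixes f :: "real \<Rightarrow> real"
  assumes "\<And>t. (f has_real_derivative f' t) (at t)"
  shows "continuous_on A f"
  using assms by (meson DERIV_isCont continuous_at_imp_continuous_on)

text \<open>Boundedness replaces initial data: the excess of x over B / d, multiplied by exp (d t),
  is nonincreasing, and its values at early times are at most a multiple of exp (d s), which tends
  to 0.\<close>

lemma damped_solution_upper:
  fixes x f :: "real \<Rightarrow> real"
  assumes d: "d > 0"
    and x: "\<And>t. (x has_real_derivative - d * x t + f t) (at t)"
    and C: "\<And>t. x t \<le> C"
    and B: "\<And>t. f t \<le> B"
  shows "x t \<le> B / d"
proof -
  define E where "E = (\<lambda>t. exp (d * t) * (x t - B / d))"
  have E': "(E has_real_derivative exp (d * t) * (f t - B)) (at t)" for t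
    unfolding E_def using d by (auto intro!: derivative_eq_intros x simp: field_simps)
  have mono: "E t \<le> E s" if "s \<le> t" for s t
    using that by (rule DERIV_nonpos_imp_nonincreasing)
      (use E' B in \<open>force intro!: mult_nonneg_nonpos\<close>)
  have "((\<lambda>s. exp (d * s) * (C - B / d)) \<longlongrightarrow> 0) at_bot"
  proof -
    have "filterlim (\<lambda>s. d * s) at_bot at_bot"
      using d by (simp add: filterlim_tendsto_pos_mult_at_bot[OF tendsto_const] filterlim_ident)
    then have "((\<lambda>s. exp (d * s)) \<longlongrightarrow> 0) at_bot"
      by (rule filterlim_compose[OF exp_at_bot])
    then show ?thesis
      by (rule tendsto_mult_left_zero)
  qed
  moreover have "eventually (\<lambda>s. E t \<le> exp (d * s) * (C - B / d)) at_bot"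
  proof (rule eventually_mono[OF eventually_le_at_bot[of t]])
    fix s assume "s \<le> t"
    then have "E t \<le> E s" by (rule mono)
    also have "\<dots> \<le> exp (d * s) * (C - B / d)"
      unfolding E_def using C[of s] by (intro mult_left_mono) auto
    finally show "E t \<le> exp (d * s) * (C - B / d)" .
  qed
  ultimately have "E t \<le> 0"
    by (intro tendsto_lowerbound) auto
  then show ?thesis
    by (simp add: E_def mult_le_0_iff)
qed

lemma damped_solution_bound:
  fixes x f :: "real \<Rightarrow> real"
  assumes d: "d > 0"
    and x: "\<And>t. (x has_real_derivative - d * x t + f t) (at t)"
    and C: "\<And>t. \<bar>x t\<bar> \<le> C"
    and B: "\<And>t. \<bar>f t\<bar> \<le> B"
  shows "\<bar>x t\<bar> \<le> B / d"
proof -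
  have "x t \<le> B / d"
    by (rule damped_solution_upper[OF d x]) (use C B in \<open>auto simp: abs_le_iff\<close>)
  moreover have "- x t \<le> B / d"
  proof (rule damped_solution_upper[OF d, of "\<lambda>t. - x t" "\<lambda>t. - f t"])
    show "((\<lambda>t. - x t) has_real_derivative - d * - x t + - f t) (at t)" for t
      by (auto intro!: derivative_eq_intros x)
  qed (use C B in \<open>auto simp: abs_le_iff\<close>)
  ultimately show ?thesis by linarith
qed

text \<open>The solution is exp (- d t) times the integral of exp (d s) f s over s < t. The improper
  integral appears as P t - c, with P an antiderivative and c its limit at -\<infinity>.\<close>

lemma damped_solution_exists:
  fixes f :: "real \<Rightarrow> real"
  assumes d: "d > 0" and f: "continuous_on UNIV f" and B: "\<And>t. \<bar>f t\<bar> \<le> B"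
  shows "\<exists>x. (\<forall>t. (x has_real_derivative - d * x t + f t) (at t)) \<and> (\<forall>t. \<bar>x t\<bar> \<le> B / d)"
proof -
  have "\<exists>P. \<forall>t::real. - \<infinity> < ereal t \<longrightarrow> ereal t < \<infinity> \<longrightarrow>
      (P has_vector_derivative exp (d * t) * f t) (at t)"
    by (rule einterval_antiderivative)
      (use f in \<open>auto intro!: continuous_intros simp: continuous_on_eq_continuous_at\<close>)
  then obtain P where P: "(P has_real_derivative exp (d * t) * f t) (at t)" for t
    by (auto simp: has_real_derivative_iff_has_vector_derivative)
  \<comment> \<open>U is nondecreasing, V nonincreasing, and U - V shrinks to 0 at -\<infinity>. So
    the supremum of V is the limit of P there, and V \<le> c \<le> U is exactly the bound B / d on
    the solution.\<close>
  define U where "U = (\<lambda>t. P t + B / d * exp (d * t))"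
  define V where "V = (\<lambda>t. P t - B / d * exp (d * t))"
  have U': "(U has_real_derivative exp (d * t) * (B + f t)) (at t)" for t
    unfolding U_def using d by (auto intro!: derivative_eq_intros P simp: field_simps)
  have V': "(V has_real_derivative - exp (d * t) * (B - f t)) (at t)" for t
    unfolding V_def using d by (auto intro!: derivative_eq_intros P simp: field_simps)
  have BB: "0 \<le> B + f t" "0 \<le> B - f t" for t
    using B[of t] by linarith+
  have Um: "U s \<le> U t" if "s \<le> t" for s t
    using that by (rule DERIV_nonneg_imp_nondecreasing) (use U' BB in force)
  have Vm: "V t \<le> V s" if "s \<le> t" for s t
    using that by (rule DERIV_nonpos_imp_nonincreasing)
      (use V' BB in \<open>force intro!: mult_nonneg_nonneg\<close>)
  have "B \<ge> 0" using B[of 0] by linarith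
  then have VU0: "V t \<le> U t" for t
    unfolding U_def V_def using d by (simp add: divide_nonneg_pos)
  have VU: "V t \<le> U s" for s t
    using Um[of "min s t" s] Vm[of "min s t" t] VU0[of "min s t"] by linarith
  define c where "c = (SUP t. V t)"
  have bdd: "bdd_above (range V)"
    using VU[of _ 0] by (auto intro!: bdd_aboveI)
  have Vc: "V t \<le> c" for t
    unfolding c_def by (rule cSUP_upper[OF _ bdd]) simp
  have cU: "c \<le> U t" for t
    unfolding c_def by (rule cSUP_least) (auto simp: VU)
  define x where "x = (\<lambda>t. exp (- d * t) * (P t - c))"
  have "(x has_real_derivative - d * x t + f t) (at t)" for t
    unfolding x_def
    by (auto intro!: derivative_eq_intros P simp: algebra_simps exp_minus)
  moreover have "\<bar>x t\<bar> \<le> B / d" for t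
  proof -
    have "\<bar>P t - c\<bar> \<le> B / d * exp (d * t)"
      using Vc[of t] cU[of t] unfolding U_def V_def by linarith
    then have "exp (- d * t) * \<bar>P t - c\<bar> \<le> exp (- d * t) * (B / d * exp (d * t))"
      by (intro mult_left_mono) auto
    also have "\<dots> = B / d"
      by (simp add: exp_minus)
    finally show ?thesis
      by (simp add: x_def abs_mult)
  qed
  ultimately show ?thesis by blast
qed

lemma damped_system_bounded_solution:
  fixes g h :: "real \<Rightarrow> real \<Rightarrow> real \<Rightarrow> real"
  assumes d: "d > 0" "d \<le> a" "d \<le> b" and l: "4 * l < d"
    and gc: "continuous_on UNIV (\<lambda>(t, x, y). g t x y)"
    and hc: "continuous_on UNIV (\<lambda>(t, x, y). h t x y)"
    and gl: "\<And>t x y x' y'. \<bar>g t x y - g t x' y'\<bar> \<le> l * (\<bar>x - x'\<bar> + \<bar>y - y'\<bar>)"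
    and hl: "\<And>t x y x' y'. \<bar>h t x y - h t x' y'\<bar> \<le> l * (\<bar>x - x'\<bar> + \<bar>y - y'\<bar>)"
    and g0: "\<And>t. \<bar>g t 0 0\<bar> \<le> B" and h0: "\<And>t. \<bar>h t 0 0\<bar> \<le> B"
  obtains x y :: "real \<Rightarrow> real" and C
  where "\<And>t. (x has_real_derivative - a * x t + g t (x t) (y t)) (at t)"
    and "\<And>t. (y has_real_derivative - b * y t + h t (x t) (y t)) (at t)"
    and "\<And>t. \<bar>x t\<bar> \<le> C" and "\<And>t. \<bar>y t\<bar> \<le> C"
proof -
  have l0: "l \<ge> 0" using gl[of 0 0 0 1 0] by (simp add: abs_if split: if_splits)
  \<comment> \<open>The rate and the source are parameters, so that \<open>ex\<close> and
    \<open>lip\<close> serve both components.\<close>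
  define good where "good = (\<lambda>a g (X :: (real \<Rightarrow>\<^sub>C real) \<times> (real \<Rightarrow>\<^sub>C real)) (u :: real \<Rightarrow>\<^sub>C real).
    \<forall>t. (apply_bcontfun u has_real_derivative 
      - a * u t + g t (apply_bcontfun (fst X) t) (apply_bcontfun (snd X) t)) (at t))"
  have ex: "\<exists>u. good a g X u"
    if a: "d \<le> a" and gc: "continuous_on UNIV (\<lambda>(t, x, y). g t x y)"
    and gl: "\<And>t x y x' y'. \<bar>g t x y - g t x' y'\<bar> \<le> l * (\<bar>x - x'\<bar> + \<bar>y - y'\<bar>)"
    and g0: "\<And>t. \<bar>g t 0 0\<bar> \<le> B" for a g X
  proof -
    define f where "f = (\<lambda>t. g t (apply_bcontfun (fst X) t) (apply_bcontfun (snd X) t))"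
    have fc: "continuous_on UNIV f"
    proof -
      have "continuous_on UNIV (\<lambda>t. (t, apply_bcontfun (fst X) t, apply_bcontfun (snd X) t))"
        by (intro continuous_intros continuous_on_apply_bcontfun)
      then show ?thesis
        using continuous_on_compose2[OF gc] unfolding f_def by fastforce
    qed
    have fb: "\<bar>f t\<bar> \<le> B + l * (norm (fst X) + norm (snd X))" for t
    proof -
      have "\<bar>f t - g t 0 0\<bar> \<le> l * (\<bar>apply_bcontfun (fst X) t\<bar> + \<bar>apply_bcontfun (snd X) t\<bar>)"
        using gl[of t "apply_bcontfun (fst X) t" "apply_bcontfun (snd X) t" 0 0] by (simp add: f_def)
      also have "\<dots> \<le> l * (norm (fst X) + norm (snd X))"
        using norm_bounded[of "fst X" t] norm_bounded[of "snd X" t] l0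
        by (intro mult_left_mono) auto
      finally show ?thesis using g0[of t] by linarith
    qed
    have "a > 0" using d a by linarith
    obtain u where u: "(u has_real_derivative - a * u t + f t) (at t)"
        "\<bar>u t\<bar> \<le> (B + l * (norm (fst X) + norm (snd X))) / a" for t
      using damped_solution_exists[OF \<open>a > 0\<close> fc fb] by blast
    have "u \<in> bcontfun"
      by (rule bcontfun_normI[OF has_real_derivative_continuous[OF u(1)]]) (use u(2) in auto)
    then have "apply_bcontfun (Bcontfun u) = u"
      by (rule Bcontfun_inverse)
    then show ?thesis
      using u(1) by (intro exI[of _ "Bcontfun u"]) (simp add: good_def f_def)
  qed
  have lip: "dist u u' \<le> 2 * l / d * dist X X'"
    if a: "d \<le> a" and u: "good a g X u" "good a g X' u'"
    and gl: "\<And>t x y x' y'. \<bar>g t x y - g t x' y'\<bar> \<le> l * (\<bar>x - x'\<bar> + \<bar>y - y'\<bar>)"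
    for a g X X' u u'
  proof (rule dist_bound)
    fix t
    have "a > 0" using d a by linarith
    have "\<bar>u t - u' t\<bar> \<le> (2 * l * dist X X') / a"
    proof (rule damped_solution_bound[OF \<open>a > 0\<close>, where x = "\<lambda>t. u t - u' t" and
          f = "\<lambda>t. g t (apply_bcontfun (fst X) t) (apply_bcontfun (snd X) t)
            - g t (apply_bcontfun (fst X') t) (apply_bcontfun (snd X') t)" and C = "dist u u'"])
      show "((\<lambda>t. u t - u' t) has_real_derivative - a * (u t - u' t) +
          (g t (apply_bcontfun (fst X) t) (apply_bcontfun (snd X) t)
            - g t (apply_bcontfun (fst X') t) (apply_bcontfun (snd X') t))) (at t)" for t
        using u unfolding good_def
        by (auto intro!: derivative_eq_intros simp: algebra_simps)
      show "\<bar>u t - u' t\<bar> \<le> dist u u'" for t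
        using dist_bounded[of u t u'] by (simp add: dist_real_def)
      show "\<bar>g t (apply_bcontfun (fst X) t) (apply_bcontfun (snd X) t)
          - g t (apply_bcontfun (fst X') t) (apply_bcontfun (snd X') t)\<bar> \<le> 2 * l * dist X X'" for t
      proof -
        have "\<bar>apply_bcontfun (fst X) t - apply_bcontfun (fst X') t\<bar> \<le> dist X X'"
          using dist_bounded[of "fst X" t "fst X'"] dist_fst_le[of X X']
          by (simp add: dist_real_def)
        moreover have "\<bar>apply_bcontfun (snd X) t - apply_bcontfun (snd X') t\<bar> \<le> dist X X'"
          using dist_bounded[of "snd X" t "snd X'"] dist_snd_le[of X X']
          by (simp add: dist_real_def)
        ultimately have "l * (\<bar>apply_bcontfun (fst X) t - apply_bcontfun (fst X') t\<bar>
            + \<bar>apply_bcontfun (snd X) t - apply_bcontfun (snd X') t\<bar>) \<le> l * (2 * dist X X')"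
          using l0 by (intro mult_left_mono) auto
        then show ?thesis
          using gl[of t "apply_bcontfun (fst X) t" "apply_bcontfun (snd X) t"
              "apply_bcontfun (fst X') t" "apply_bcontfun (snd X') t"] by linarith
      qed
    qed
    also have "\<dots> \<le> (2 * l * dist X X') / d"
      using a d l0 by (intro divide_left_mono) auto
    finally show "dist (u t) (u' t) \<le> 2 * l / d * dist X X'"
      by (simp add: dist_real_def)
  qed
  obtain S where S: "good a g X (S X)" for X
    using ex[OF d(2) gc gl g0] by metis
  obtain T where T: "good b h X (T X)" for X
    using ex[OF d(3) hc hl h0] by metis
  have "\<exists>!X. (S X, T X) = X"
  proof (rule banach_fix_type[of "4 * l / d"], goal_cases)
    case 3
    show ?case
    proof (intro allI)
      fix X X'
      have "dist (S X, T X) (S X', T X') \<le> dist (S X) (S X') + dist (T X) (T X')"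
        unfolding dist_Pair_Pair by (rule sqrt_sum_squares_le_sum) auto
      also have "\<dots> \<le> 2 * l / d * dist X X' + 2 * l / d * dist X X'"
        by (intro add_mono lip[OF d(2) S S gl] lip[OF d(3) T T hl])
      finally show "dist (S X, T X) (S X', T X') \<le> 4 * l / d * dist X X'"
        by simp
    qed
  qed (use d l l0 in auto)
  then obtain X where X: "S X = fst X" "T X = snd X"
    by (metis fst_conv snd_conv)
  show ?thesis
  proof (rule that[of "fst X" "snd X" "norm (fst X) + norm (snd X)"])
    show "(fst X has_real_derivative - a * apply_bcontfun (fst X) t
        + g t (apply_bcontfun (fst X) t) (apply_bcontfun (snd X) t)) (at t)" for t
      using S[of X] by (simp add: good_def X)
    show "(snd X has_real_derivative - b * apply_bcontfun (snd X) t
        + h t (apply_bcontfun (fst X) t) (apply_bcontfun (snd X) t)) (at t)" for t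
      using T[of X] by (simp add: good_def X)
    show "\<bar>apply_bcontfun (fst X) t\<bar> \<le> norm (fst X) + norm (snd X)" for t
      using norm_bounded[of "fst X" t] by (simp add: add_increasing2)
    show "\<bar>apply_bcontfun (snd X) t\<bar> \<le> norm (fst X) + norm (snd X)" for t
      using norm_bounded[of "snd X" t] by (simp add: add_increasing)
  qed
qed

subsection \<open>The unstable manifold of a saddle\<close>

definition clip :: "real \<Rightarrow> real \<Rightarrow> real" where
  "clip \<delta> x = max (- \<delta>) (min \<delta> x)"

lemma abs_clip_le: "0 \<le> \<delta> \<Longrightarrow> \<bar>clip \<delta> x\<bar> \<le> \<delta>" "0 \<le> \<delta> \<Longrightarrow> \<bar>clip \<delta> x\<bar> \<le> \<bar>x\<bar>"
  by (auto simp: clip_def abs_if min_def max_def)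

lemma clip_lipschitz: "\<bar>clip \<delta> x - clip \<delta> y\<bar> \<le> \<bar>x - y\<bar>"
  by (auto simp: clip_def abs_if min_def max_def)

lemma clip_ident: "\<bar>x\<bar> \<le> \<delta> \<Longrightarrow> clip \<delta> x = x"
  by (auto simp: clip_def abs_if min_def max_def split: if_splits)

text \<open>
  A quantitative form of vanishing to order \<open>m\<close> at the origin: on the box of radius \<open>\<delta>\<close> the function
  is \<open>O(\<delta>\<^sup>m)\<close> with Lipschitz constant \<open>O(\<delta>\<^sup>m\<^sup>-\<^sup>1)\<close>, uniformly in \<open>\<delta> \<le> D\<close>.
\<close>
definition scaled_lipschitz :: "real \<Rightarrow> nat \<Rightarrow> (real \<Rightarrow> real \<Rightarrow> real) \<Rightarrow> bool" where
  "scaled_lipschitz D m f \<longleftrightarrow> (\<exists>C. \<forall>\<delta> x y x' y'. \<delta> \<le> D \<longrightarrow>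
     \<bar>x\<bar> \<le> \<delta> \<longrightarrow> \<bar>y\<bar> \<le> \<delta> \<longrightarrow> \<bar>x'\<bar> \<le> \<delta> \<longrightarrow> \<bar>y'\<bar> \<le> \<delta> \<longrightarrow>
     \<bar>f x y\<bar> \<le> C * \<delta> ^ m \<and> \<delta> * \<bar>f x y - f x' y'\<bar> \<le> C * \<delta> ^ m * (\<bar>x - x'\<bar> + \<bar>y - y'\<bar>))"

lemma scaled_lipschitzI:
  assumes "\<And>\<delta> x y x' y'. 0 \<le> \<delta> \<Longrightarrow> \<delta> \<le> D \<Longrightarrow> \<bar>x\<bar> \<le> \<delta> \<Longrightarrow> \<bar>y\<bar> \<le> \<delta> \<Longrightarrow> \<bar>x'\<bar> \<le> \<delta> \<Longrightarrow> \<bar>y'\<bar> \<le> \<delta> \<Longrightarrow>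
     \<bar>f x y\<bar> \<le> C * \<delta> ^ m \<and> \<delta> * \<bar>f x y - f x' y'\<bar> \<le> C * \<delta> ^ m * (\<bar>x - x'\<bar> + \<bar>y - y'\<bar>)"
  shows "scaled_lipschitz D m f"
  unfolding scaled_lipschitz_def
proof (rule exI[of _ C], intro allI impI)
  fix \<delta> x y x' y' :: real
  assume "\<delta> \<le> D" "\<bar>x\<bar> \<le> \<delta>" "\<bar>y\<bar> \<le> \<delta>" "\<bar>x'\<bar> \<le> \<delta>" "\<bar>y'\<bar> \<le> \<delta>"
  then show "\<bar>f x y\<bar> \<le> C * \<delta> ^ m \<and> \<delta> * \<bar>f x y - f x' y'\<bar> \<le> C * \<delta> ^ m * (\<bar>x - x'\<bar> + \<bar>y - y'\<bar>)"
    by (intro assms) (auto intro: order_trans[OF abs_ge_zero])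
qed

lemma scaled_lipschitzE:
  assumes "scaled_lipschitz D m f"
  obtains C where "C \<ge> 0"
    and "\<And>\<delta> x y. \<delta> \<le> D \<Longrightarrow> \<bar>x\<bar> \<le> \<delta> \<Longrightarrow> \<bar>y\<bar> \<le> \<delta> \<Longrightarrow> \<bar>f x y\<bar> \<le> C * \<delta> ^ m"
    and "\<And>\<delta> x y x' y'. \<delta> \<le> D \<Longrightarrow> \<bar>x\<bar> \<le> \<delta> \<Longrightarrow> \<bar>y\<bar> \<le> \<delta> \<Longrightarrow> \<bar>x'\<bar> \<le> \<delta> \<Longrightarrow> \<bar>y'\<bar> \<le> \<delta> \<Longrightarrow>
      \<delta> * \<bar>f x y - f x' y'\<bar> \<le> C * \<delta> ^ m * (\<bar>x - x'\<bar> + \<bar>y - y'\<bar>)"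
proof -
  obtain C where C: "\<delta> \<le> D \<Longrightarrow> \<bar>x\<bar> \<le> \<delta> \<Longrightarrow> \<bar>y\<bar> \<le> \<delta> \<Longrightarrow> \<bar>x'\<bar> \<le> \<delta> \<Longrightarrow> \<bar>y'\<bar> \<le> \<delta> \<Longrightarrow>
     \<bar>f x y\<bar> \<le> C * \<delta> ^ m \<and> \<delta> * \<bar>f x y - f x' y'\<bar> \<le> C * \<delta> ^ m * (\<bar>x - x'\<bar> + \<bar>y - y'\<bar>)"
    for \<delta> x y x' y'
    using assms unfolding scaled_lipschitz_def by blast
  have le: "C * \<delta> ^ m \<le> \<bar>C\<bar> * \<delta> ^ m" if "\<bar>x\<bar> \<le> \<delta>" for \<delta> x :: real
    using order_trans[OF abs_ge_zero that] by (intro mult_right_mono) auto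
  show ?thesis
  proof (rule that[of "\<bar>C\<bar>"])
    show "\<bar>f x y\<bar> \<le> \<bar>C\<bar> * \<delta> ^ m" if "\<delta> \<le> D" "\<bar>x\<bar> \<le> \<delta>" "\<bar>y\<bar> \<le> \<delta>" for \<delta> x y
      using C[of \<delta> x y x y] le[OF that(2)] that by linarith
    show "\<delta> * \<bar>f x y - f x' y'\<bar> \<le> \<bar>C\<bar> * \<delta> ^ m * (\<bar>x - x'\<bar> + \<bar>y - y'\<bar>)"
      if "\<delta> \<le> D" "\<bar>x\<bar> \<le> \<delta>" "\<bar>y\<bar> \<le> \<delta>" "\<bar>x'\<bar> \<le> \<delta>" "\<bar>y'\<bar> \<le> \<delta>" for \<delta> x y x' y'
      by (rule order_trans[OF conjunct2[OF C[OF that]] mult_right_mono[OF le[OF that(2)]]]) simp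
  qed simp
qed

section \<open>Order of vanishing under sums, products and inverses\<close>

lemma scaled_lipschitz_const: "scaled_lipschitz D 0 (\<lambda>_ _. c)"
  by (rule scaled_lipschitzI[of _ _ "\<bar>c\<bar>"]) auto

lemma scaled_lipschitz_fst: "scaled_lipschitz D 1 (\<lambda>x _. x)"
  by (rule scaled_lipschitzI[of _ _ 1]) (auto intro!: mult_left_mono)

lemma scaled_lipschitz_snd: "scaled_lipschitz D 1 (\<lambda>_ y. y)"
  by (rule scaled_lipschitzI[of _ _ 1]) (auto intro!: mult_left_mono)

lemma scaled_lipschitz_add:
  assumes "scaled_lipschitz D m f" "scaled_lipschitz D m g"
  shows "scaled_lipschitz D m (\<lambda>x y. f x y + g x y)"
proof -
  obtain A where A: "A \<ge> 0"
    "\<And>\<delta> x y. \<delta> \<le> D \<Longrightarrow> \<bar>x\<bar> \<le> \<delta> \<Longrightarrow> \<bar>y\<bar> \<le> \<delta> \<Longrightarrow> \<bar>f x y\<bar> \<le> A * \<delta> ^ m"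
    "\<And>\<delta> x y x' y'. \<delta> \<le> D \<Longrightarrow> \<bar>x\<bar> \<le> \<delta> \<Longrightarrow> \<bar>y\<bar> \<le> \<delta> \<Longrightarrow> \<bar>x'\<bar> \<le> \<delta> \<Longrightarrow> \<bar>y'\<bar> \<le> \<delta> \<Longrightarrow>
      \<delta> * \<bar>f x y - f x' y'\<bar> \<le> A * \<delta> ^ m * (\<bar>x - x'\<bar> + \<bar>y - y'\<bar>)"
    by (rule scaled_lipschitzE[OF assms(1)], rule that)
  obtain B where B: "B \<ge> 0"
    "\<And>\<delta> x y. \<delta> \<le> D \<Longrightarrow> \<bar>x\<bar> \<le> \<delta> \<Longrightarrow> \<bar>y\<bar> \<le> \<delta> \<Longrightarrow> \<bar>g x y\<bar> \<le> B * \<delta> ^ m"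
    "\<And>\<delta> x y x' y'. \<delta> \<le> D \<Longrightarrow> \<bar>x\<bar> \<le> \<delta> \<Longrightarrow> \<bar>y\<bar> \<le> \<delta> \<Longrightarrow> \<bar>x'\<bar> \<le> \<delta> \<Longrightarrow> \<bar>y'\<bar> \<le> \<delta> \<Longrightarrow>
      \<delta> * \<bar>g x y - g x' y'\<bar> \<le> B * \<delta> ^ m * (\<bar>x - x'\<bar> + \<bar>y - y'\<bar>)"
    by (rule scaled_lipschitzE[OF assms(2)], rule that)
  show ?thesis
  proof (rule scaled_lipschitzI[of _ _ "A + B"], intro conjI)
    fix \<delta> x y x' y' :: real
    assume *: "0 \<le> \<delta>" "\<delta> \<le> D" "\<bar>x\<bar> \<le> \<delta>" "\<bar>y\<bar> \<le> \<delta>" "\<bar>x'\<bar> \<le> \<delta>" "\<bar>y'\<bar> \<le> \<delta>"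
    show "\<bar>f x y + g x y\<bar> \<le> (A + B) * \<delta> ^ m"
      using A(2)[OF *(2-4)] B(2)[OF *(2-4)] by (simp add: distrib_right)
    have "\<delta> * \<bar>f x y + g x y - (f x' y' + g x' y')\<bar>
        \<le> \<delta> * (\<bar>f x y - f x' y'\<bar> + \<bar>g x y - g x' y'\<bar>)"
      using *(1) by (intro mult_left_mono) auto
    then show "\<delta> * \<bar>f x y + g x y - (f x' y' + g x' y')\<bar>
        \<le> (A + B) * \<delta> ^ m * (\<bar>x - x'\<bar> + \<bar>y - y'\<bar>)"
      using A(3)[OF *(2-6)] B(3)[OF *(2-6)] by (simp add: algebra_simps)
  qed
qed

lemma scaled_lipschitz_mult:
  assumes "scaled_lipschitz D l f" "scaled_lipschitz D m g"
  shows "scaled_lipschitz D (l + m) (\<lambda>x y. f x y * g x y)"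
proof -
  obtain A where A: "A \<ge> 0"
    "\<And>\<delta> x y. \<delta> \<le> D \<Longrightarrow> \<bar>x\<bar> \<le> \<delta> \<Longrightarrow> \<bar>y\<bar> \<le> \<delta> \<Longrightarrow> \<bar>f x y\<bar> \<le> A * \<delta> ^ l"
    "\<And>\<delta> x y x' y'. \<delta> \<le> D \<Longrightarrow> \<bar>x\<bar> \<le> \<delta> \<Longrightarrow> \<bar>y\<bar> \<le> \<delta> \<Longrightarrow> \<bar>x'\<bar> \<le> \<delta> \<Longrightarrow> \<bar>y'\<bar> \<le> \<delta> \<Longrightarrow>
      \<delta> * \<bar>f x y - f x' y'\<bar> \<le> A * \<delta> ^ l * (\<bar>x - x'\<bar> + \<bar>y - y'\<bar>)"
    by (rule scaled_lipschitzE[OF assms(1)], rule that)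
  obtain B where B: "B \<ge> 0"
    "\<And>\<delta> x y. \<delta> \<le> D \<Longrightarrow> \<bar>x\<bar> \<le> \<delta> \<Longrightarrow> \<bar>y\<bar> \<le> \<delta> \<Longrightarrow> \<bar>g x y\<bar> \<le> B * \<delta> ^ m"
    "\<And>\<delta> x y x' y'. \<delta> \<le> D \<Longrightarrow> \<bar>x\<bar> \<le> \<delta> \<Longrightarrow> \<bar>y\<bar> \<le> \<delta> \<Longrightarrow> \<bar>x'\<bar> \<le> \<delta> \<Longrightarrow> \<bar>y'\<bar> \<le> \<delta> \<Longrightarrow>
      \<delta> * \<bar>g x y - g x' y'\<bar> \<le> B * \<delta> ^ m * (\<bar>x - x'\<bar> + \<bar>y - y'\<bar>)"
    by (rule scaled_lipschitzE[OF assms(2)], rule that)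
  show ?thesis
  \<comment> \<open>The increment of a product splits into two terms, each with constant A *
    B.\<close>
  proof (rule scaled_lipschitzI[of _ _ "2 * A * B"], intro conjI)
    fix \<delta> x y x' y' :: real
    assume *: "0 \<le> \<delta>" "\<delta> \<le> D" "\<bar>x\<bar> \<le> \<delta>" "\<bar>y\<bar> \<le> \<delta>" "\<bar>x'\<bar> \<le> \<delta>" "\<bar>y'\<bar> \<le> \<delta>"
    define e where "e = \<bar>x - x'\<bar> + \<bar>y - y'\<bar>"
    have e: "e \<ge> 0" by (simp add: e_def)
    have "\<bar>f x y\<bar> * \<bar>g x y\<bar> \<le> (A * \<delta> ^ l) * (B * \<delta> ^ m)"
      using * A(1) B(1) by (intro mult_mono A B) auto
    moreover have "0 \<le> (A * \<delta> ^ l) * (B * \<delta> ^ m)"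
      using * A(1) B(1) by auto
    ultimately show "\<bar>f x y * g x y\<bar> \<le> 2 * A * B * \<delta> ^ (l + m)"
      by (simp add: abs_mult power_add algebra_simps)
    have "f x y * g x y - f x' y' * g x' y' =
        f x y * (g x y - g x' y') + (f x y - f x' y') * g x' y'"
      by (simp add: algebra_simps)
    then have "\<bar>f x y * g x y - f x' y' * g x' y'\<bar> \<le>
        \<bar>f x y\<bar> * \<bar>g x y - g x' y'\<bar> + \<bar>f x y - f x' y'\<bar> * \<bar>g x' y'\<bar>"
      by (metis abs_mult abs_triangle_ineq)
    from mult_left_mono[OF this *(1)]
    have "\<delta> * \<bar>f x y * g x y - f x' y' * g x' y'\<bar> \<le>
        \<bar>f x y\<bar> * (\<delta> * \<bar>g x y - g x' y'\<bar>) + (\<delta> * \<bar>f x y - f x' y'\<bar>) * \<bar>g x' y'\<bar>"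
      by (simp add: algebra_simps)
    also have "\<dots> \<le> (A * \<delta> ^ l) * (B * \<delta> ^ m * e) + (A * \<delta> ^ l * e) * (B * \<delta> ^ m)"
      by (rule add_mono[OF
            mult_mono[OF A(2)[OF *(2-4)] B(3)[OF *(2-6), folded e_def]]
            mult_mono[OF A(3)[OF *(2-6), folded e_def] B(2)[OF *(2,5,6)]]])
        (use *(1) A(1) B(1) e in auto)
    also have "\<dots> = 2 * A * B * \<delta> ^ (l + m) * e"
      by (simp add: power_add)
    finally show "\<delta> * \<bar>f x y * g x y - f x' y' * g x' y'\<bar> \<le>
        2 * A * B * \<delta> ^ (l + m) * (\<bar>x - x'\<bar> + \<bar>y - y'\<bar>)"
      unfolding e_def .
  qed
qed

text \<open>Surplus powers of \<delta> go into the constant through \<delta> \<le> D. It allows a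
  factor such as \<open>1 + (x + y)\<^sup>2\<close> to be treated as a function of order 0.\<close>

lemma scaled_lipschitz_weaken:
  assumes "scaled_lipschitz D (l + m) f"
  shows "scaled_lipschitz D m f"
proof -
  obtain A where A: "A \<ge> 0"
    "\<And>\<delta> x y. \<delta> \<le> D \<Longrightarrow> \<bar>x\<bar> \<le> \<delta> \<Longrightarrow> \<bar>y\<bar> \<le> \<delta> \<Longrightarrow> \<bar>f x y\<bar> \<le> A * \<delta> ^ (l + m)"
    "\<And>\<delta> x y x' y'. \<delta> \<le> D \<Longrightarrow> \<bar>x\<bar> \<le> \<delta> \<Longrightarrow> \<bar>y\<bar> \<le> \<delta> \<Longrightarrow> \<bar>x'\<bar> \<le> \<delta> \<Longrightarrow> \<bar>y'\<bar> \<le> \<delta> \<Longrightarrow>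
      \<delta> * \<bar>f x y - f x' y'\<bar> \<le> A * \<delta> ^ (l + m) * (\<bar>x - x'\<bar> + \<bar>y - y'\<bar>)"
    by (rule scaled_lipschitzE[OF assms(1)], rule that)
  show ?thesis
  proof (rule scaled_lipschitzI[of _ _ "A * D ^ l"], intro conjI)
    fix \<delta> x y x' y' :: real
    assume *: "0 \<le> \<delta>" "\<delta> \<le> D" "\<bar>x\<bar> \<le> \<delta>" "\<bar>y\<bar> \<le> \<delta>" "\<bar>x'\<bar> \<le> \<delta>" "\<bar>y'\<bar> \<le> \<delta>"
    have le: "A * \<delta> ^ (l + m) \<le> A * D ^ l * \<delta> ^ m"
      unfolding power_add mult.assoc using * A(1)
      by (intro mult_left_mono mult_right_mono power_mono) auto
    show "\<bar>f x y\<bar> \<le> A * D ^ l * \<delta> ^ m"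
      using A(2)[OF *(2-4)] le by linarith
    have "A * \<delta> ^ (l + m) * (\<bar>x - x'\<bar> + \<bar>y - y'\<bar>) \<le> A * D ^ l * \<delta> ^ m * (\<bar>x - x'\<bar> + \<bar>y - y'\<bar>)"
      by (intro mult_right_mono le) auto
    then show "\<delta> * \<bar>f x y - f x' y'\<bar> \<le> A * D ^ l * \<delta> ^ m * (\<bar>x - x'\<bar> + \<bar>y - y'\<bar>)"
      using A(3)[OF *(2-6)] by linarith
  qed
qed

lemma scaled_lipschitz_inverse:
  assumes "scaled_lipschitz D 0 f" and f: "\<And>x y. f x y \<ge> 1"
  shows "scaled_lipschitz D 0 (\<lambda>x y. 1 / f x y)"
proof -
  obtain A where A: "A \<ge> 0"
    "\<And>\<delta> x y. \<delta> \<le> D \<Longrightarrow> \<bar>x\<bar> \<le> \<delta> \<Longrightarrow> \<bar>y\<bar> \<le> \<delta> \<Longrightarrow> \<bar>f x y\<bar> \<le> A * \<delta> ^ 0"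
    "\<And>\<delta> x y x' y'. \<delta> \<le> D \<Longrightarrow> \<bar>x\<bar> \<le> \<delta> \<Longrightarrow> \<bar>y\<bar> \<le> \<delta> \<Longrightarrow> \<bar>x'\<bar> \<le> \<delta> \<Longrightarrow> \<bar>y'\<bar> \<le> \<delta> \<Longrightarrow>
      \<delta> * \<bar>f x y - f x' y'\<bar> \<le> A * \<delta> ^ 0 * (\<bar>x - x'\<bar> + \<bar>y - y'\<bar>)"
    by (rule scaled_lipschitzE[OF assms(1)], rule that)
  show ?thesis
  proof (rule scaled_lipschitzI[of _ _ "1 + A"], intro conjI)
    fix \<delta> x y x' y' :: real
    assume *: "0 \<le> \<delta>" "\<delta> \<le> D" "\<bar>x\<bar> \<le> \<delta>" "\<bar>y\<bar> \<le> \<delta>" "\<bar>x'\<bar> \<le> \<delta>" "\<bar>y'\<bar> \<le> \<delta>"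
    have f0: "f x y > 0" for x y using f[of x y] by linarith
    show "\<bar>1 / f x y\<bar> \<le> (1 + A) * \<delta> ^ 0"
      using mult_mono[of 1 "1 + A" 1 "f x y"] f[of x y] f0[of x y] A(1)
      by (simp add: divide_le_eq)
    have "1 / f x y - 1 / f x' y' = (f x' y' - f x y) / (f x y * f x' y')"
      using f0[of x y] f0[of x' y'] by (simp add: field_simps)
    moreover have "1 \<le> f x y * f x' y'"
      using f[of x y] f[of x' y'] mult_mono[of 1 "f x y" 1 "f x' y'"] by simp
    ultimately have "\<bar>1 / f x y - 1 / f x' y'\<bar> \<le> \<bar>f x y - f x' y'\<bar>"
      using divide_left_mono[of 1 "f x y * f x' y'" "\<bar>f x y - f x' y'\<bar>"]
      by (simp add: abs_minus_commute)
    then have "\<delta> * \<bar>1 / f x y - 1 / f x' y'\<bar> \<le> \<delta> * \<bar>f x y - f x' y'\<bar>"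
      using *(1) by (rule mult_left_mono)
    also have "\<dots> \<le> A * (\<bar>x - x'\<bar> + \<bar>y - y'\<bar>)"
      using A(3)[OF *(2-6)] by simp
    also have "\<dots> \<le> (1 + A) * (\<bar>x - x'\<bar> + \<bar>y - y'\<bar>)"
      by (intro mult_right_mono) auto
    finally show "\<delta> * \<bar>1 / f x y - 1 / f x' y'\<bar> \<le> (1 + A) * \<delta> ^ 0 * (\<bar>x - x'\<bar> + \<bar>y - y'\<bar>)"
      by simp
  qed
qed

text \<open>The three bounds have separate uses: the uniform one controls the source of the second
  contraction, the quadratic one makes the first source comparable to exp (2 \<alpha> t), and the
  Lipschitz constant becomes small with \<delta>.\<close>

lemma scaled_lipschitz_cubic_clip:
  assumes "scaled_lipschitz D 3 R"
  obtains K where "K \<ge> 0"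
    and "\<And>\<delta> x y. 0 < \<delta> \<Longrightarrow> \<delta> \<le> D \<Longrightarrow> \<bar>R (clip \<delta> x) (clip \<delta> y)\<bar> \<le> K * \<delta> ^ 3"
    and "\<And>\<delta> x y. 0 < \<delta> \<Longrightarrow> \<delta> \<le> D \<Longrightarrow> \<bar>R (clip \<delta> x) (clip \<delta> y)\<bar> \<le> K * \<delta> * (\<bar>x\<bar> + \<bar>y\<bar>)\<^sup>2"
    and "\<And>\<delta> x y x' y'. 0 < \<delta> \<Longrightarrow> \<delta> \<le> D \<Longrightarrow>
      \<bar>R (clip \<delta> x) (clip \<delta> y) - R (clip \<delta> x') (clip \<delta> y')\<bar> \<le> K * \<delta>\<^sup>2 * (\<bar>x - x'\<bar> + \<bar>y - y'\<bar>)"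
proof -
  obtain K where K: "K \<ge> 0"
    "\<And>\<delta> x y. \<delta> \<le> D \<Longrightarrow> \<bar>x\<bar> \<le> \<delta> \<Longrightarrow> \<bar>y\<bar> \<le> \<delta> \<Longrightarrow> \<bar>R x y\<bar> \<le> K * \<delta> ^ 3"
    "\<And>\<delta> x y x' y'. \<delta> \<le> D \<Longrightarrow> \<bar>x\<bar> \<le> \<delta> \<Longrightarrow> \<bar>y\<bar> \<le> \<delta> \<Longrightarrow> \<bar>x'\<bar> \<le> \<delta> \<Longrightarrow> \<bar>y'\<bar> \<le> \<delta> \<Longrightarrow>
      \<delta> * \<bar>R x y - R x' y'\<bar> \<le> K * \<delta> ^ 3 * (\<bar>x - x'\<bar> + \<bar>y - y'\<bar>)"
    by (rule scaled_lipschitzE[OF assms(1)], rule that)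
  show ?thesis
  proof (rule that[OF K(1)])
    fix \<delta> x y x' y' :: real
    assume \<delta>: "0 < \<delta>" "\<delta> \<le> D"
    show "\<bar>R (clip \<delta> x) (clip \<delta> y)\<bar> \<le> K * \<delta> ^ 3"
      using \<delta> by (intro K(2) abs_clip_le) auto
    \<comment> \<open>The clipped point already lies in the smaller box of radius \<mu>. Of the
      three factors \<mu> one is bounded by \<delta> and two by the size of (x, y).\<close>
    define \<mu> where "\<mu> = min \<delta> (\<bar>x\<bar> + \<bar>y\<bar>)"
    have "\<bar>clip \<delta> x\<bar> \<le> \<mu>" "\<bar>clip \<delta> y\<bar> \<le> \<mu>"
      using abs_clip_le[of \<delta> x] abs_clip_le[of \<delta> y] \<delta> by (auto simp: \<mu>_def)
    then have "\<bar>R (clip \<delta> x) (clip \<delta> y)\<bar> \<le> K * \<mu> ^ 3"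
      using \<delta> by (intro K(2)) (auto simp: \<mu>_def)
    also have "\<dots> = K * (\<mu> * \<mu>\<^sup>2)"
      by (simp add: eval_nat_numeral)
    also have "\<dots> \<le> K * (\<delta> * (\<bar>x\<bar> + \<bar>y\<bar>)\<^sup>2)"
      using \<delta> K(1) by (intro mult_left_mono mult_mono power_mono) (auto simp: \<mu>_def)
    finally show "\<bar>R (clip \<delta> x) (clip \<delta> y)\<bar> \<le> K * \<delta> * (\<bar>x\<bar> + \<bar>y\<bar>)\<^sup>2"
      by (simp add: mult.assoc)
    have "\<delta> * \<bar>R (clip \<delta> x) (clip \<delta> y) - R (clip \<delta> x') (clip \<delta> y')\<bar>
        \<le> K * \<delta> ^ 3 * (\<bar>clip \<delta> x - clip \<delta> x'\<bar> + \<bar>clip \<delta> y - clip \<delta> y'\<bar>)"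
      using \<delta> by (intro K(3) abs_clip_le) auto
    also have "\<dots> \<le> K * \<delta> ^ 3 * (\<bar>x - x'\<bar> + \<bar>y - y'\<bar>)"
      using \<delta> K(1) by (intro mult_left_mono add_mono clip_lipschitz) auto
    also have "\<dots> = \<delta> * (K * \<delta>\<^sup>2 * (\<bar>x - x'\<bar> + \<bar>y - y'\<bar>))"
      by (simp add: eval_nat_numeral algebra_simps)
    finally show "\<bar>R (clip \<delta> x) (clip \<delta> y) - R (clip \<delta> x') (clip \<delta> y')\<bar>
        \<le> K * \<delta>\<^sup>2 * (\<bar>x - x'\<bar> + \<bar>y - y'\<bar>)"
      using \<delta>(1) by simp
  qed
qed

lemma continuous_on_sum_lipschitz:
  fixes f :: "real \<Rightarrow> real \<Rightarrow> real"
  assumes f: "\<And>x y x' y'. \<bar>f x y - f x' y'\<bar> \<le> l * (\<bar>x - x'\<bar> + \<bar>y - y'\<bar>)"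
  shows "continuous_on UNIV (\<lambda>z. f (fst z) (snd z))"
proof -
  have l0: "l \<ge> 0" using f[of 0 0 1 0] by (simp add: abs_if split: if_splits)
  have "(2 * l)-lipschitz_on UNIV (\<lambda>z. f (fst z) (snd z))"
  proof (rule lipschitz_onI)
    fix z w :: "real \<times> real"
    have "\<bar>f (fst z) (snd z) - f (fst w) (snd w)\<bar> \<le> l * (\<bar>fst z - fst w\<bar> + \<bar>snd z - snd w\<bar>)"
      by (rule f)
    also have "\<dots> \<le> l * (dist z w + dist z w)"
      using dist_fst_le[of z w] dist_snd_le[of z w] l0
      by (intro mult_left_mono add_mono) (auto simp: dist_real_def)
    finally show "dist (f (fst z) (snd z)) (f (fst w) (snd w)) \<le> 2 * l * dist z w"
      by (simp add: dist_real_def)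
  qed (use l0 in simp)
  then show ?thesis
    by (rule lipschitz_on_continuous_on)
qed

lemma clip_comp_continuous:
  assumes "\<And>x y x' y'. \<bar>R (clip \<delta> x) (clip \<delta> y) - R (clip \<delta> x') (clip \<delta> y')\<bar> \<le> l * (\<bar>x - x'\<bar> + \<bar>y - y'\<bar>)"
    and "continuous_on A p" and "continuous_on A q"
  shows "continuous_on A (\<lambda>z. R (clip \<delta> (p z)) (clip \<delta> (q z)))"
  using continuous_on_compose2[OF continuous_on_sum_lipschitz[of "\<lambda>x y. R (clip \<delta> x) (clip \<delta> y)" l]
      continuous_on_Pair[OF assms(2,3)]] assms(1) by fastforce

lemma exp_half_square: "exp (a * t :: real) ^ 2 = exp (2 * a * t)"
  by (simp add: exp_double[symmetric] mult.assoc)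

text \<open>
  Ansatz \<open>(\<phi>, \<psi>) = exp (\<alpha> t) (1, \<alpha>) + exp (2 \<alpha> t) (x (1, \<alpha>) + y (1, - \<beta>))\<close> with bounded \<open>x\<close>, \<open>y\<close>.
\<close>
lemma local_unstable_orbit:
  fixes R :: "real \<Rightarrow> real \<Rightarrow> real"
  assumes \<alpha>: "\<alpha> > 0" and \<beta>: "\<beta> > 0" and D: "D > 0" and R: "scaled_lipschitz D 3 R"
  obtains \<delta> \<phi> \<psi> C where "0 < \<delta>" "\<delta> \<le> D"
    and "\<And>t. (\<phi> has_real_derivative \<psi> t) (at t)"
    and "\<And>t. (\<psi> has_real_derivative
      \<alpha> * \<beta> * \<phi> t + (\<alpha> - \<beta>) * \<psi> t + R (clip \<delta> (\<phi> t)) (clip \<delta> (\<psi> t))) (at t)"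
    and "\<And>t. \<bar>\<phi> t - exp (\<alpha> * t)\<bar> \<le> C * exp (2 * \<alpha> * t)"
    and "\<And>t. \<bar>\<psi> t - \<alpha> * exp (\<alpha> * t)\<bar> \<le> C * exp (2 * \<alpha> * t)"
proof -
  obtain K where K: "K \<ge> 0"
    "\<And>\<delta> x y. 0 < \<delta> \<Longrightarrow> \<delta> \<le> D \<Longrightarrow> \<bar>R (clip \<delta> x) (clip \<delta> y)\<bar> \<le> K * \<delta> ^ 3"
    "\<And>\<delta> x y. 0 < \<delta> \<Longrightarrow> \<delta> \<le> D \<Longrightarrow> \<bar>R (clip \<delta> x) (clip \<delta> y)\<bar> \<le> K * \<delta> * (\<bar>x\<bar> + \<bar>y\<bar>)\<^sup>2"
    "\<And>\<delta> x y x' y'. 0 < \<delta> \<Longrightarrow> \<delta> \<le> D \<Longrightarrow>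
      \<bar>R (clip \<delta> x) (clip \<delta> y) - R (clip \<delta> x') (clip \<delta> y')\<bar> \<le> K * \<delta>\<^sup>2 * (\<bar>x - x'\<bar> + \<bar>y - y'\<bar>)"
    by (rule scaled_lipschitz_cubic_clip[OF R], rule that)
  \<comment> \<open>\<open>c * \<delta>\<^sup>2\<close> is four times the Lipschitz constant
    \<open>l\<close> below, and the contraction needs it to be less than the damping \<alpha>. For
    \<delta> \<le> 1 a condition linear in \<delta> suffices; c + 1 keeps the quotient defined when
    c = 0.\<close>
  define c where "c = 4 * (K * (1 + \<alpha> + \<beta>) / (\<alpha> + \<beta>))"
  have c: "c \<ge> 0" using K(1) \<alpha> \<beta> by (simp add: c_def)
  define \<delta> where "\<delta> = min D (min 1 (\<alpha> / (2 * (c + 1))))"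
  have \<delta>: "0 < \<delta>" "\<delta> \<le> D" "\<delta> \<le> 1" "\<delta> \<le> \<alpha> / (2 * (c + 1))"
    using D \<alpha> c by (auto simp: \<delta>_def)
  have small: "c * \<delta>\<^sup>2 < \<alpha>"
  proof -
    have "c * \<delta>\<^sup>2 \<le> c * \<delta>"
      using \<delta>(1,3) c by (intro mult_left_mono) (auto simp: power2_eq_square mult_left_le)
    also have "\<dots> \<le> (c + 1) * (\<alpha> / (2 * (c + 1)))"
      using \<delta>(1,4) c by (intro mult_mono) auto
    also have "\<dots> < \<alpha>"
      using \<alpha> c by (simp add: field_simps add_pos_nonneg)
    finally show ?thesis .
  qed
  define p where "p = (\<lambda>t x y. exp (\<alpha> * t) + exp (2 * \<alpha> * t) * (x + y) :: real)"
  define q where "q = (\<lambda>t x y. \<alpha> * exp (\<alpha> * t) + exp (2 * \<alpha> * t) * (\<alpha> * x - \<beta> * y) :: real)"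
  define Q where "Q = (\<lambda>t x y. R (clip \<delta> (p t x y)) (clip \<delta> (q t x y)))"
  \<comment> \<open>The nonlinearity acts along (0, 1) = ((1, \<alpha>) - (1, - \<beta>)) /
    (\<alpha> + \<beta>), so x receives g and y receives - g. Dividing by the weight exp (2 \<alpha>
    t) shifts the eigenvalues \<alpha> and - \<beta> to - \<alpha> and - (2 \<alpha> + \<beta>), so
    both equations are damped.\<close>
  define g where "g = (\<lambda>t x y. exp (- 2 * \<alpha> * t) * Q t x y / (\<alpha> + \<beta>))"
  define l where "l = K * (1 + \<alpha> + \<beta>) / (\<alpha> + \<beta>) * \<delta>\<^sup>2"
  have l4: "4 * l < \<alpha>"
    using small by (simp add: l_def c_def)
  have gc: "continuous_on UNIV (\<lambda>(t, x, y). g t x y)"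
    unfolding g_def Q_def case_prod_beta p_def q_def
    using \<alpha> \<beta> by (intro continuous_intros clip_comp_continuous[OF K(4)[OF \<delta>(1,2)]]) auto
  have gl: "\<bar>g t x y - g t x' y'\<bar> \<le> l * (\<bar>x - x'\<bar> + \<bar>y - y'\<bar>)" for t x y x' y'
  proof -
    have px: "p t x y - p t x' y' = exp (2 * \<alpha> * t) * ((x - x') + (y - y'))"
      by (simp add: p_def algebra_simps)
    have qx: "q t x y - q t x' y' = exp (2 * \<alpha> * t) * (\<alpha> * (x - x') - \<beta> * (y - y'))"
      by (simp add: q_def algebra_simps)
    have "\<bar>p t x y - p t x' y'\<bar> + \<bar>q t x y - q t x' y'\<bar> =
        exp (2 * \<alpha> * t) * (\<bar>(x - x') + (y - y')\<bar> + \<bar>\<alpha> * (x - x') - \<beta> * (y - y')\<bar>)"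
      unfolding px qx abs_mult by (simp add: distrib_left)
    also have "\<dots> \<le> exp (2 * \<alpha> * t) * ((1 + \<alpha> + \<beta>) * (\<bar>x - x'\<bar> + \<bar>y - y'\<bar>))"
    proof (rule mult_left_mono)
      have "\<bar>\<alpha> * (x - x') - \<beta> * (y - y')\<bar> \<le> \<alpha> * \<bar>x - x'\<bar> + \<beta> * \<bar>y - y'\<bar>"
        using abs_triangle_ineq4[of "\<alpha> * (x - x')" "\<beta> * (y - y')"] \<alpha> \<beta> by (simp add: abs_mult)
      moreover have "\<bar>(x - x') + (y - y')\<bar> \<le> \<bar>x - x'\<bar> + \<bar>y - y'\<bar>"
        by (rule abs_triangle_ineq)
      moreover have "0 \<le> \<alpha> * \<bar>y - y'\<bar>" "0 \<le> \<beta> * \<bar>x - x'\<bar>"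
        using \<alpha> \<beta> by auto
      ultimately show "\<bar>(x - x') + (y - y')\<bar> + \<bar>\<alpha> * (x - x') - \<beta> * (y - y')\<bar>
          \<le> (1 + \<alpha> + \<beta>) * (\<bar>x - x'\<bar> + \<bar>y - y'\<bar>)"
        by (simp add: distrib_left distrib_right)
    qed simp
    finally have "\<bar>Q t x y - Q t x' y'\<bar> \<le>
        K * \<delta>\<^sup>2 * (exp (2 * \<alpha> * t) * ((1 + \<alpha> + \<beta>) * (\<bar>x - x'\<bar> + \<bar>y - y'\<bar>)))"
      unfolding Q_def
      by (intro order_trans[OF K(4)[OF \<delta>(1,2)]] mult_left_mono) (use K(1) in auto)
    then have "exp (- 2 * \<alpha> * t) / (\<alpha> + \<beta>) * \<bar>Q t x y - Q t x' y'\<bar> \<le>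
        exp (- 2 * \<alpha> * t) / (\<alpha> + \<beta>) *
        (K * \<delta>\<^sup>2 * (exp (2 * \<alpha> * t) * ((1 + \<alpha> + \<beta>) * (\<bar>x - x'\<bar> + \<bar>y - y'\<bar>))))"
      using \<alpha> \<beta> by (intro mult_left_mono) auto
    also have "\<dots> = l * (\<bar>x - x'\<bar> + \<bar>y - y'\<bar>)"
      by (simp add: l_def exp_minus)
    also have "exp (- 2 * \<alpha> * t) / (\<alpha> + \<beta>) * \<bar>Q t x y - Q t x' y'\<bar> = \<bar>g t x y - g t x' y'\<bar>"
    proof -
      have "g t x y - g t x' y' = exp (- 2 * \<alpha> * t) / (\<alpha> + \<beta>) * (Q t x y - Q t x' y')"
        unfolding g_def by (simp add: right_diff_distrib diff_divide_distrib)
      then show ?thesis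
        using \<alpha> \<beta> by (simp add: abs_mult)
    qed
    finally show ?thesis .
  qed
  \<comment> \<open>The leading term exp (\<alpha> t) (1, \<alpha>) enters quadratically, which
    exactly compensates the weight.\<close>
  have g0: "\<bar>g t 0 0\<bar> \<le> K * \<delta> * (1 + \<alpha>)\<^sup>2 / (\<alpha> + \<beta>)" for t
  proof -
    have "\<bar>Q t 0 0\<bar> \<le> K * \<delta> * (\<bar>exp (\<alpha> * t)\<bar> + \<bar>\<alpha> * exp (\<alpha> * t)\<bar>)\<^sup>2"
      unfolding Q_def by (rule order_trans[OF K(3)[OF \<delta>(1,2)]]) (simp add: p_def q_def)
    also have "\<bar>exp (\<alpha> * t)\<bar> + \<bar>\<alpha> * exp (\<alpha> * t)\<bar> = (1 + \<alpha>) * exp (\<alpha> * t)"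
      using \<alpha> by (simp add: abs_mult distrib_right)
    finally have "\<bar>Q t 0 0\<bar> \<le> K * \<delta> * (1 + \<alpha>)\<^sup>2 * exp (2 * \<alpha> * t)"
      by (simp add: power_mult_distrib exp_half_square)
    then have "exp (- 2 * \<alpha> * t) / (\<alpha> + \<beta>) * \<bar>Q t 0 0\<bar> \<le>
        exp (- 2 * \<alpha> * t) / (\<alpha> + \<beta>) * (K * \<delta> * (1 + \<alpha>)\<^sup>2 * exp (2 * \<alpha> * t))"
      using \<alpha> \<beta> by (intro mult_left_mono) auto
    also have "\<dots> = K * \<delta> * (1 + \<alpha>)\<^sup>2 / (\<alpha> + \<beta>) * (exp (- 2 * \<alpha> * t) * exp (2 * \<alpha> * t))"
      by simp
    also have "exp (- 2 * \<alpha> * t) * exp (2 * \<alpha> * t) = 1"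
      by (simp add: exp_minus)
    finally show ?thesis
      using \<alpha> \<beta> by (simp add: g_def abs_mult)
  qed
  obtain x y C where xy: "\<And>t. (x has_real_derivative - \<alpha> * x t + g t (x t) (y t)) (at t)"
      "\<And>t. (y has_real_derivative - (2 * \<alpha> + \<beta>) * y t + - g t (x t) (y t)) (at t)"
      "\<And>t. \<bar>x t\<bar> \<le> C" "\<And>t. \<bar>y t\<bar> \<le> C"
  proof (rule damped_system_bounded_solution[of \<alpha> \<alpha> "2 * \<alpha> + \<beta>" l g "\<lambda>t x y. - g t x y"])
    show "continuous_on UNIV (\<lambda>(t, x, y). - g t x y)"
      using continuous_on_minus[OF gc] by (simp add: case_prod_beta)
    show "\<bar>- g t x y - - g t x' y'\<bar> \<le> l * (\<bar>x - x'\<bar> + \<bar>y - y'\<bar>)" for t x y x' y'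
      using gl[of t x y x' y'] by (simp add: abs_minus_commute)
    show "\<bar>- g t 0 0\<bar> \<le> K * \<delta> * (1 + \<alpha>)\<^sup>2 / (\<alpha> + \<beta>)" for t
      using g0 by simp
  qed (use \<alpha> \<beta> l4 gc gl g0 in auto)
  have C: "C \<ge> 0" using order_trans[OF abs_ge_zero xy(3)] .
  show ?thesis
  proof (rule that[OF \<delta>(1,2), of "\<lambda>t. p t (x t) (y t)" "\<lambda>t. q t (x t) (y t)" "(2 + \<alpha> + \<beta>) * C"])
    fix t
    have gQ: "exp (2 * \<alpha> * t) * g t (x t) (y t) = Q t (x t) (y t) / (\<alpha> + \<beta>)"
      by (simp add: g_def exp_minus)
    have Qs: "Q t (x t) (y t) = \<alpha> * (Q t (x t) (y t) / (\<alpha> + \<beta>)) + \<beta> * (Q t (x t) (y t) / (\<alpha> + \<beta>))"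
      unfolding distrib_right[symmetric] using \<alpha> \<beta> by simp
    show "((\<lambda>t. p t (x t) (y t)) has_real_derivative q t (x t) (y t)) (at t)"
      unfolding p_def q_def
      by (auto intro!: derivative_eq_intros xy(1,2) simp: algebra_simps)
    have "((\<lambda>t. q t (x t) (y t)) has_real_derivative
        \<alpha> * (\<alpha> * exp (\<alpha> * t)) + 2 * \<alpha> * exp (2 * \<alpha> * t) * (\<alpha> * x t - \<beta> * y t)
        + exp (2 * \<alpha> * t) * (- \<alpha> * \<alpha> * x t + \<beta> * (2 * \<alpha> + \<beta>) * y t)
        + (\<alpha> * (exp (2 * \<alpha> * t) * g t (x t) (y t)) + \<beta> * (exp (2 * \<alpha> * t) * g t (x t) (y t)))) (at t)"
      unfolding q_def
      by (auto intro!: derivative_eq_intros xy(1,2) simp: algebra_simps)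
    also have "\<alpha> * (exp (2 * \<alpha> * t) * g t (x t) (y t)) + \<beta> * (exp (2 * \<alpha> * t) * g t (x t) (y t))
        = Q t (x t) (y t)"
      unfolding gQ Qs[symmetric] ..
    also have "\<alpha> * (\<alpha> * exp (\<alpha> * t)) + 2 * \<alpha> * exp (2 * \<alpha> * t) * (\<alpha> * x t - \<beta> * y t)
        + exp (2 * \<alpha> * t) * (- \<alpha> * \<alpha> * x t + \<beta> * (2 * \<alpha> + \<beta>) * y t)
        = \<alpha> * \<beta> * p t (x t) (y t) + (\<alpha> - \<beta>) * q t (x t) (y t)"
      unfolding p_def q_def by (simp add: algebra_simps)
    finally show "((\<lambda>t. q t (x t) (y t)) has_real_derivative
        \<alpha> * \<beta> * p t (x t) (y t) + (\<alpha> - \<beta>) * q t (x t) (y t)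
        + R (clip \<delta> (p t (x t) (y t))) (clip \<delta> (q t (x t) (y t)))) (at t)"
      unfolding Q_def .
    have "\<bar>p t (x t) (y t) - exp (\<alpha> * t)\<bar> = exp (2 * \<alpha> * t) * \<bar>x t + y t\<bar>"
      by (simp add: p_def abs_mult)
    also have "\<dots> \<le> exp (2 * \<alpha> * t) * ((2 + \<alpha> + \<beta>) * C)"
    proof (rule mult_left_mono)
      have "0 \<le> \<alpha> * C" "0 \<le> \<beta> * C" using \<alpha> \<beta> C by auto
      then show "\<bar>x t + y t\<bar> \<le> (2 + \<alpha> + \<beta>) * C"
        using xy(3)[of t] xy(4)[of t] by (simp add: distrib_right)
    qed simp
    finally show "\<bar>p t (x t) (y t) - exp (\<alpha> * t)\<bar> \<le> (2 + \<alpha> + \<beta>) * C * exp (2 * \<alpha> * t)"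
      by (simp add: mult.commute)
    have "\<bar>q t (x t) (y t) - \<alpha> * exp (\<alpha> * t)\<bar> = exp (2 * \<alpha> * t) * \<bar>\<alpha> * x t - \<beta> * y t\<bar>"
      by (simp add: q_def abs_mult)
    also have "\<dots> \<le> exp (2 * \<alpha> * t) * ((2 + \<alpha> + \<beta>) * C)"
    proof (rule mult_left_mono)
      have "\<bar>\<alpha> * x t - \<beta> * y t\<bar> \<le> \<alpha> * \<bar>x t\<bar> + \<beta> * \<bar>y t\<bar>"
        using abs_triangle_ineq4[of "\<alpha> * x t" "\<beta> * y t"] \<alpha> \<beta> by (simp add: abs_mult)
      also have "\<dots> \<le> \<alpha> * C + \<beta> * C"
        using \<alpha> \<beta> xy(3,4) by (intro add_mono mult_left_mono) auto
      finally show "\<bar>\<alpha> * x t - \<beta> * y t\<bar> \<le> (2 + \<alpha> + \<beta>) * C"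
        using C by (simp add: distrib_right)
    qed simp
    finally show "\<bar>q t (x t) (y t) - \<alpha> * exp (\<alpha> * t)\<bar> \<le> (2 + \<alpha> + \<beta>) * C * exp (2 * \<alpha> * t)"
      by (simp add: mult.commute)
  qed
qed

lemma exp_mult_at_bot: "a > 0 \<Longrightarrow> ((\<lambda>t. exp (a * t :: real)) \<longlongrightarrow> 0) at_bot"
  by (rule filterlim_compose[OF exp_at_bot])
    (simp add: filterlim_tendsto_pos_mult_at_bot[OF tendsto_const] filterlim_ident)

lemma exp_asymptotic_tendsto_0:
  fixes f :: "real \<Rightarrow> real"
  assumes "\<alpha> > 0" and f: "\<And>t. t \<le> 0 \<Longrightarrow> \<bar>f t - c * exp (\<alpha> * t)\<bar> \<le> C * exp (2 * \<alpha> * t)"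
  shows "(f \<longlongrightarrow> 0) at_bot"
proof -
  have "((\<lambda>t. C * exp (2 * \<alpha> * t)) \<longlongrightarrow> C * 0) at_bot"
    using \<open>\<alpha> > 0\<close> by (intro tendsto_intros exp_mult_at_bot) simp
  moreover have "\<forall>\<^sub>F t in at_bot. norm (f t - c * exp (\<alpha> * t)) \<le> C * exp (2 * \<alpha> * t)"
    by (rule eventually_mono[OF eventually_le_at_bot[of 0]]) (simp add: f)
  ultimately have "((\<lambda>t. f t - c * exp (\<alpha> * t)) \<longlongrightarrow> 0) at_bot"
    by (simp add: Lim_null_comparison)
  then have "((\<lambda>t. (f t - c * exp (\<alpha> * t)) + c * exp (\<alpha> * t)) \<longlongrightarrow> 0 + c * 0) at_bot"
    using \<open>\<alpha> > 0\<close> by (intro tendsto_intros exp_mult_at_bot)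
  then show ?thesis by simp
qed

text \<open>
  The orbit of the field truncated at a small \<open>\<delta>\<close> is corrected to one of the field truncated at \<open>D\<close>.
  Both agree near \<open>- \<infinity>\<close>, so the correction decays at any rate \<open>\<gamma>\<close>, and \<open>\<gamma>\<close> is taken larger than the
  Lipschitz constant.
\<close>
lemma unstable_orbit:
  fixes R :: "real \<Rightarrow> real \<Rightarrow> real"
  assumes \<alpha>: "\<alpha> > 0" and \<beta>: "\<beta> > 0" and D: "D > 0" and R: "scaled_lipschitz D 3 R"
  obtains \<phi> \<psi> C where
    "\<And>t. (\<phi> has_real_derivative \<psi> t) (at t)"
    and "\<And>t. (\<psi> has_real_derivative
      \<alpha> * \<beta> * \<phi> t + (\<alpha> - \<beta>) * \<psi> t + R (clip D (\<phi> t)) (clip D (\<psi> t))) (at t)"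
    and "\<And>t. t \<le> 0 \<Longrightarrow> \<bar>\<phi> t - exp (\<alpha> * t)\<bar> \<le> C * exp (2 * \<alpha> * t)"
    and "\<And>t. t \<le> 0 \<Longrightarrow> \<bar>\<psi> t - \<alpha> * exp (\<alpha> * t)\<bar> \<le> C * exp (2 * \<alpha> * t)"
proof -
  obtain K where K: "K \<ge> 0"
    "\<And>\<delta> x y. 0 < \<delta> \<Longrightarrow> \<delta> \<le> D \<Longrightarrow> \<bar>R (clip \<delta> x) (clip \<delta> y)\<bar> \<le> K * \<delta> ^ 3"
    "\<And>\<delta> x y. 0 < \<delta> \<Longrightarrow> \<delta> \<le> D \<Longrightarrow> \<bar>R (clip \<delta> x) (clip \<delta> y)\<bar> \<le> K * \<delta> * (\<bar>x\<bar> + \<bar>y\<bar>)\<^sup>2"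
    "\<And>\<delta> x y x' y'. 0 < \<delta> \<Longrightarrow> \<delta> \<le> D \<Longrightarrow>
      \<bar>R (clip \<delta> x) (clip \<delta> y) - R (clip \<delta> x') (clip \<delta> y')\<bar> \<le> K * \<delta>\<^sup>2 * (\<bar>x - x'\<bar> + \<bar>y - y'\<bar>)"
    by (rule scaled_lipschitz_cubic_clip[OF R], rule that)
  obtain \<delta> \<phi> \<psi> C0 where \<delta>: "0 < \<delta>" "\<delta> \<le> D"
    and \<phi>: "\<And>t. (\<phi> has_real_derivative \<psi> t) (at t)"
    and \<psi>: "\<And>t. (\<psi> has_real_derivative
      \<alpha> * \<beta> * \<phi> t + (\<alpha> - \<beta>) * \<psi> t + R (clip \<delta> (\<phi> t)) (clip \<delta> (\<psi> t))) (at t)"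
    and C0: "\<And>t. \<bar>\<phi> t - exp (\<alpha> * t)\<bar> \<le> C0 * exp (2 * \<alpha> * t)"
      "\<And>t. \<bar>\<psi> t - \<alpha> * exp (\<alpha> * t)\<bar> \<le> C0 * exp (2 * \<alpha> * t)"
    by (rule local_unstable_orbit[OF assms], rule that)
  have cont: "continuous_on A \<phi>" "continuous_on A \<psi>" for A
    by (rule has_real_derivative_continuous, rule \<phi>, rule has_real_derivative_continuous, rule \<psi>)
  have "(\<phi> \<longlongrightarrow> 0) at_bot" "(\<psi> \<longlongrightarrow> 0) at_bot"
    by (rule exp_asymptotic_tendsto_0[OF \<alpha>, of _ 1 C0], simp only: mult_1 C0)
      (rule exp_asymptotic_tendsto_0[OF \<alpha> C0(2)])
  from this[THEN tendstoD, OF \<delta>(1)]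
  have "eventually (\<lambda>t. \<bar>\<phi> t\<bar> < \<delta> \<and> \<bar>\<psi> t\<bar> < \<delta>) at_bot"
    by (simp add: eventually_conj_iff)
  \<comment> \<open>Before T the orbit stays in the small box, where the truncations at \<delta> and
    at D agree.\<close>
  then obtain T where T: "\<And>t. t \<le> T \<Longrightarrow> \<bar>\<phi> t\<bar> < \<delta>" "\<And>t. t \<le> T \<Longrightarrow> \<bar>\<psi> t\<bar> < \<delta>"
    by (auto simp: eventually_at_bot_linorder)
  \<comment> \<open>Here the linear part counts as source, hence its coefficients in the constant;
    the summand 1 covers the source y of the first equation.\<close>
  define l where "l = 1 + \<alpha> * \<beta> + \<bar>\<alpha> - \<beta>\<bar> + K * D\<^sup>2"
  have l1: "l \<ge> 1" using \<alpha> \<beta> K(1) by (simp add: l_def)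
  \<comment> \<open>\<gamma> > 4 l makes the map a contraction, and \<gamma> \<ge> 2 \<alpha> lets
    the correction disappear in the error term exp (2 \<alpha> t) for t \<le> 0.\<close>
  define \<gamma> where "\<gamma> = 2 * \<alpha> + 4 * l + 1"
  have \<gamma>: "\<gamma> > 0" "2 * \<alpha> \<le> \<gamma>" "4 * l < \<gamma>" using \<alpha> l1 by (auto simp: \<gamma>_def)
  define S where "S = (\<lambda>\<epsilon> x y. R (clip \<epsilon> x) (clip \<epsilon> y))"
  \<comment> \<open>The correction exp (\<gamma> t) (x, y) is driven by the difference of the two
    truncated nonlinearities, rescaled by the weight.\<close>
  define Q where "Q = (\<lambda>t x y.
    exp (- \<gamma> * t) * (S D (\<phi> t + exp (\<gamma> * t) * x) (\<psi> t + exp (\<gamma> * t) * y) - S \<delta> (\<phi> t) (\<psi> t)))"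
  define h where "h = (\<lambda>t x y. \<alpha> * \<beta> * x + (\<alpha> - \<beta>) * y + Q t x y)"
  have hc: "continuous_on UNIV (\<lambda>(t, x, y). h t x y)"
    unfolding h_def Q_def S_def case_prod_beta
    by (intro continuous_intros clip_comp_continuous[OF K(4)[OF \<delta>]]
        clip_comp_continuous[OF K(4)[OF D order_refl]] continuous_on_compose2[OF cont(1)[of UNIV]]
        continuous_on_compose2[OF cont(2)[of UNIV]]) auto
  have Ql: "\<bar>Q t x y - Q t x' y'\<bar> \<le> K * D\<^sup>2 * (\<bar>x - x'\<bar> + \<bar>y - y'\<bar>)" for t x y x' y'
  proof -
    have "\<bar>S D (\<phi> t + exp (\<gamma> * t) * x) (\<psi> t + exp (\<gamma> * t) * y)
        - S D (\<phi> t + exp (\<gamma> * t) * x') (\<psi> t + exp (\<gamma> * t) * y')\<bar>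
        \<le> K * D\<^sup>2 * (\<bar>exp (\<gamma> * t) * x - exp (\<gamma> * t) * x'\<bar> + \<bar>exp (\<gamma> * t) * y - exp (\<gamma> * t) * y'\<bar>)"
      unfolding S_def by (rule order_trans[OF K(4)[OF D order_refl]]) simp
    also have "\<dots> = exp (\<gamma> * t) * (K * D\<^sup>2 * (\<bar>x - x'\<bar> + \<bar>y - y'\<bar>))"
      unfolding right_diff_distrib[symmetric] abs_mult by (simp add: algebra_simps)
    finally have "exp (- \<gamma> * t) * \<bar>S D (\<phi> t + exp (\<gamma> * t) * x) (\<psi> t + exp (\<gamma> * t) * y)
        - S D (\<phi> t + exp (\<gamma> * t) * x') (\<psi> t + exp (\<gamma> * t) * y')\<bar>
        \<le> exp (- \<gamma> * t) * (exp (\<gamma> * t) * (K * D\<^sup>2 * (\<bar>x - x'\<bar> + \<bar>y - y'\<bar>)))"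
      by (rule mult_left_mono) simp
    also have "\<dots> = K * D\<^sup>2 * (\<bar>x - x'\<bar> + \<bar>y - y'\<bar>)"
      unfolding mult.assoc[symmetric, of "exp (- \<gamma> * t)"] by (simp add: exp_minus)
    also have "exp (- \<gamma> * t) * \<bar>S D (\<phi> t + exp (\<gamma> * t) * x) (\<psi> t + exp (\<gamma> * t) * y)
        - S D (\<phi> t + exp (\<gamma> * t) * x') (\<psi> t + exp (\<gamma> * t) * y')\<bar> = \<bar>Q t x y - Q t x' y'\<bar>"
      unfolding Q_def right_diff_distrib[symmetric] abs_mult by simp
    finally show ?thesis .
  qed
  have hl: "\<bar>h t x y - h t x' y'\<bar> \<le> l * (\<bar>x - x'\<bar> + \<bar>y - y'\<bar>)" for t x y x' y'
  proof -
    have "h t x y - h t x' y' =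
        \<alpha> * \<beta> * (x - x') + (\<alpha> - \<beta>) * (y - y') + (Q t x y - Q t x' y')"
      by (simp add: h_def algebra_simps)
    then have "\<bar>h t x y - h t x' y'\<bar> \<le>
        \<bar>\<alpha> * \<beta> * (x - x')\<bar> + \<bar>(\<alpha> - \<beta>) * (y - y')\<bar> + \<bar>Q t x y - Q t x' y'\<bar>"
      by linarith
    also have "\<dots> \<le> \<alpha> * \<beta> * \<bar>x - x'\<bar> + \<bar>\<alpha> - \<beta>\<bar> * \<bar>y - y'\<bar>
        + K * D\<^sup>2 * (\<bar>x - x'\<bar> + \<bar>y - y'\<bar>)"
      using Ql \<alpha> \<beta> by (simp add: abs_mult)
    also have "\<dots> \<le> l * (\<bar>x - x'\<bar> + \<bar>y - y'\<bar>)"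
      using \<alpha> \<beta> by (simp add: l_def distrib_left distrib_right)
    finally show ?thesis .
  qed
  \<comment> \<open>The factor exp (- \<gamma> t) explodes at -\<infinity>, but the source at zero
    vanishes up to T; afterwards the factor is at most exp (- \<gamma> T).\<close>
  define B where "B = exp (- \<gamma> * T) * (K * D ^ 3 + K * \<delta> ^ 3)"
  have h0: "\<bar>h t 0 0\<bar> \<le> B" for t
  proof (cases "t \<le> T")
    case True
    then have "h t 0 0 = 0"
      using T[of t] \<delta> by (simp add: h_def Q_def S_def clip_ident)
    then show ?thesis
      using K(1) D \<delta> by (simp add: B_def)
  next
    case False
    have "\<bar>h t 0 0\<bar> = exp (- \<gamma> * t) * \<bar>S D (\<phi> t) (\<psi> t) - S \<delta> (\<phi> t) (\<psi> t)\<bar>"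
      by (simp add: h_def Q_def abs_mult)
    also have "\<dots> \<le> exp (- \<gamma> * T) * (K * D ^ 3 + K * \<delta> ^ 3)"
    proof (rule mult_mono)
      show "\<bar>S D (\<phi> t) (\<psi> t) - S \<delta> (\<phi> t) (\<psi> t)\<bar> \<le> K * D ^ 3 + K * \<delta> ^ 3"
        using K(2)[OF \<delta>, of "\<phi> t" "\<psi> t"] K(2)[OF D order_refl, of "\<phi> t" "\<psi> t"]
        unfolding S_def by linarith
    qed (use False \<gamma> in auto)
    finally show ?thesis by (simp add: B_def)
  qed
  obtain x y C where xy: "\<And>t. (x has_real_derivative - \<gamma> * x t + y t) (at t)"
      "\<And>t. (y has_real_derivative - \<gamma> * y t + h t (x t) (y t)) (at t)"
      "\<And>t. \<bar>x t\<bar> \<le> C" "\<And>t. \<bar>y t\<bar> \<le> C"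
  proof (rule damped_system_bounded_solution[of \<gamma> \<gamma> \<gamma> l "\<lambda>t x y. y" h])
    show "continuous_on UNIV (\<lambda>(t :: real, x :: real, y :: real). y)"
      unfolding case_prod_beta by (intro continuous_intros)
    show "\<bar>y - y'\<bar> \<le> l * (\<bar>x - x'\<bar> + \<bar>y - y'\<bar>)" for x y x' y' :: real
    proof -
      have "1 * \<bar>y - y'\<bar> \<le> l * (\<bar>x - x'\<bar> + \<bar>y - y'\<bar>)"
        using l1 by (intro mult_mono) auto
      then show ?thesis by simp
    qed
    show "\<bar>0\<bar> \<le> B" using order_trans[OF abs_ge_zero h0] by simp
  qed (use \<gamma> hc hl h0 in auto)
  define \<Phi> where "\<Phi> = (\<lambda>t. \<phi> t + exp (\<gamma> * t) * x t)"
  define \<Psi> where "\<Psi> = (\<lambda>t. \<psi> t + exp (\<gamma> * t) * y t)"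
  have C: "C \<ge> 0" using order_trans[OF abs_ge_zero xy(3)] .
  have small: "\<bar>f + exp (\<gamma> * t) * u - e\<bar> \<le> (C0 + C) * exp (2 * \<alpha> * t)"
    if "\<bar>f - e\<bar> \<le> C0 * exp (2 * \<alpha> * t)" "\<bar>u\<bar> \<le> C" "t \<le> 0" for f u e t
  proof -
    have "\<gamma> * t \<le> 2 * \<alpha> * t"
      using \<gamma>(2) that(3) by (rule mult_right_mono_neg)
    then have "\<bar>exp (\<gamma> * t) * u\<bar> \<le> exp (2 * \<alpha> * t) * C"
      unfolding abs_mult using that(2) by (intro mult_mono) auto
    then show ?thesis
      using that(1) by (simp add: distrib_right mult.commute)
  qed
  show ?thesis
  proof (rule that[of \<Phi> \<Psi> "C0 + C"])
    show "(\<Phi> has_real_derivative \<Psi> t) (at t)" for t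
      unfolding \<Phi>_def \<Psi>_def
      by (auto intro!: derivative_eq_intros \<phi> xy(1) simp: algebra_simps)
    show "(\<Psi> has_real_derivative
      \<alpha> * \<beta> * \<Phi> t + (\<alpha> - \<beta>) * \<Psi> t + R (clip D (\<Phi> t)) (clip D (\<Psi> t))) (at t)" for t
    proof -
      have "exp (\<gamma> * t) * Q t (x t) (y t) = S D (\<Phi> t) (\<Psi> t) - S \<delta> (\<phi> t) (\<psi> t)"
        unfolding Q_def \<Phi>_def \<Psi>_def mult.assoc[symmetric] by (simp add: exp_minus)
      then have eq: "S D (\<Phi> t) (\<Psi> t) = exp (\<gamma> * t) * Q t (x t) (y t) + S \<delta> (\<phi> t) (\<psi> t)"
        by simp
      have "(\<Psi> has_real_derivative
        \<alpha> * \<beta> * \<Phi> t + (\<alpha> - \<beta>) * \<Psi> t + S D (\<Phi> t) (\<Psi> t)) (at t)"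
        unfolding eq unfolding \<Phi>_def \<Psi>_def
        by (auto intro!: derivative_eq_intros \<psi> xy(2) simp: h_def S_def algebra_simps)
      then show ?thesis by (simp add: S_def)
    qed
    show "\<bar>\<Phi> t - exp (\<alpha> * t)\<bar> \<le> (C0 + C) * exp (2 * \<alpha> * t)" if "t \<le> 0" for t
      unfolding \<Phi>_def by (rule small[OF C0(1) xy(3) that])
    show "\<bar>\<Psi> t - \<alpha> * exp (\<alpha> * t)\<bar> \<le> (C0 + C) * exp (2 * \<alpha> * t)" if "t \<le> 0" for t
      unfolding \<Psi>_def by (rule small[OF C0(2) xy(4) that])
  qed
qed

subsection \<open>The barrier\<close>

lemma scaled_lipschitz_linear: "scaled_lipschitz D 1 (\<lambda>x y. a * x + b * y)"
  using scaled_lipschitz_add[OF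
      scaled_lipschitz_mult[OF scaled_lipschitz_const scaled_lipschitz_fst, of D a]
      scaled_lipschitz_mult[OF scaled_lipschitz_const scaled_lipschitz_snd, of D b]]
  by simp

text \<open>
  The parameters are \<open>n\<close>, \<open>r = p / (n - p)\<close>, the rates \<open>\<alpha> = k - 1\<close> and \<open>- \<beta> = - (n + k)\<close> of the
  linearisation at the origin, and \<open>M = \<alpha> \<beta> / n\<close>. In these terms \<open>\<lambda>\<^sup>2 = (1 + M) (1 + r) / r\<close> and
  \<open>\<kappa> = 1 / \<phi>\<^sub>0\<^sup>2\<close>.
\<close>
locale node_field =
  fixes n M r \<alpha> \<beta> :: real
  assumes n: "n > 0" and M: "M > 0" and r: "r > 0" and \<alpha>: "\<alpha> > 0"
    and \<beta>: "\<beta> = \<alpha> + n + 1" and \<alpha>\<beta>: "\<alpha> * \<beta> = n * M"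
    and barrier: "\<And>x. 0 \<le> x \<Longrightarrow> x < M \<Longrightarrow>
      4 * (M + 1) * (1 + x + r * x) * (x\<^sup>2 + M * x + 3 * x - M) <
      n * (1 + x) * ((1 + x)\<^sup>2 * (M + 1) + r * x * (1 + 2 * M - x)\<^sup>2)
      + 2 * (M + 1) * (1 + x)\<^sup>2 * (1 + x + r * x)"
begin

section \<open>The field in normalised parameters\<close>

definition \<kappa> :: real where "\<kappa> = (M + 1) / (r * M)"

text \<open>The denominator \<open>1 + \<lambda>\<^sup>2 * \<phi>\<^sup>2\<close> of the system,
  because \<open>M * (1 + r) * \<kappa> = \<lambda>\<^sup>2\<close>.\<close>

definition s :: "real \<Rightarrow> real" where "s x = 1 + M * (1 + r) * (\<kappa> * x\<^sup>2)"

definition field :: "real \<Rightarrow> real \<Rightarrow> real" where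
  "field x y = - y - n * ((1 + M * (\<kappa> * x\<^sup>2)) * y - M * (1 - \<kappa> * x\<^sup>2) * x) * (1 + (x + y)\<^sup>2) / s x"

text \<open>\<open>gap x y > 0\<close> says that \<open>y\<close> is below the barrier, twice the zero of the bracket in \<open>field\<close>.\<close>
definition gap :: "real \<Rightarrow> real \<Rightarrow> real" where
  "gap x y = 2 * M * (1 - \<kappa> * x\<^sup>2) * x - (1 + M * (\<kappa> * x\<^sup>2)) * y"

definition x0 :: real where "x0 = sqrt (1 / \<kappa>)"

text \<open>Below the barrier x < \<open>x0\<close> and y \<le> 2 M x, so this radius bounds even x
  + y. Truncating at it therefore leaves the trapped region untouched.\<close>

definition box :: real where "box = (1 + 2 * M) * x0"

text \<open>An upper bound below the barrier for the total coefficient of - y in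
  \<open>field\<close>, from \<open>\<kappa> * x\<^sup>2 < 1\<close>, \<open>s x \<ge> 1\<close> and
  x + y \<le> \<open>box\<close>.\<close>

definition damping :: real where "damping = 1 + n * (1 + M) * (1 + box\<^sup>2)"

lemma \<kappa>_pos: "\<kappa> > 0"
  using M r by (simp add: \<kappa>_def)

lemma x0_pos: "x0 > 0"
  using \<kappa>_pos by (simp add: x0_def)

lemma \<kappa>_x0: "\<kappa> * x0\<^sup>2 = 1"
  using \<kappa>_pos by (simp add: x0_def)

lemma box_pos: "box > 0"
  using M x0_pos by (simp add: box_def)

lemma damping_pos: "damping > 0"
  using M n by (simp add: damping_def add_pos_nonneg)

lemma s_ge_1: "s x \<ge> 1"
  using M r \<kappa>_pos by (simp add: s_def)

lemma s_pos: "s x > 0"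
  using s_ge_1[of x] by linarith

lemma \<beta>_pos: "\<beta> > 0"
  using \<alpha> n \<beta> by simp

text \<open>The relations between the parameters give n (M - \<alpha>) = \<alpha> (\<alpha> + 1).
  The orbit thus leaves the origin with slope \<alpha>, below the slope 2 M of the barrier.\<close>

lemma \<alpha>_less_M: "\<alpha> < M"
proof -
  have "0 < \<alpha> * (\<alpha> + 1)" using \<alpha> by simp
  then have "n * \<alpha> < n * M"
    unfolding \<alpha>\<beta>[symmetric] \<beta> by (simp add: algebra_simps)
  then show ?thesis using n by simp
qed

text \<open>The relations for \<alpha> and \<beta> make the subtracted part n M x - (n + 1) y, the
  linear part of \<open>field\<close>. The remainder is a sum of two products of three linear forms,
  one of them times a bounded factor.\<close>

lemma nonlinearity_cubic:
  "scaled_lipschitz D 3 (\<lambda>x y. field x y - (\<alpha> * \<beta> * x + (\<alpha> - \<beta>) * y))"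
proof -
  define lin where "lin = (\<lambda>a b x y :: real. a * x + b * y)"
  have lin: "scaled_lipschitz D 1 (lin a b)" for a b
    unfolding lin_def by (rule scaled_lipschitz_linear)
  have sq: "scaled_lipschitz D 2 (\<lambda>x y. lin a b x y * lin a b x y)" for a b
    using scaled_lipschitz_mult[OF lin lin] by (simp add: numeral_2_eq_2)
  have cubic: "scaled_lipschitz D 3 (\<lambda>x y. lin c d x y * (lin a b x y * lin a b x y))" for a b c d
    using scaled_lipschitz_mult[OF lin sq] by (simp add: numeral_3_eq_3)
  have weak: "scaled_lipschitz D 0 (\<lambda>x y. 1 + lin a b x y * lin a b x y)" for a b
    by (rule scaled_lipschitz_add[OF scaled_lipschitz_const scaled_lipschitz_weaken[of D 2 0]])
      (simp add: sq)
  \<comment> \<open>Writing \<open>s\<close> as 1 plus the square of a linear form puts it in the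
    same shape as \<open>1 + (x + y)\<^sup>2\<close>, so \<open>weak\<close> applies to
    both.\<close>
  have s_eq: "s x = 1 + lin (sqrt (M * (1 + r) * \<kappa>)) 0 x y * lin (sqrt (M * (1 + r) * \<kappa>)) 0 x y" for x y
  proof -
    have "M * (1 + r) * \<kappa> \<ge> 0" using M r \<kappa>_pos by simp
    then have "sqrt (M * (1 + r) * \<kappa>) * sqrt (M * (1 + r) * \<kappa>) = M * (1 + r) * \<kappa>"
      by simp
    then show ?thesis
      by (simp add: s_def lin_def power2_eq_square algebra_simps)
  qed
  have "scaled_lipschitz D 0 (\<lambda>x y. s x)"
    using weak[of "sqrt (M * (1 + r) * \<kappa>)" 0] by (simp only: s_eq[symmetric])
  then have "scaled_lipschitz D 0 (\<lambda>x y. 1 / s x)"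
    by (rule scaled_lipschitz_inverse) (rule s_ge_1)
  from scaled_lipschitz_mult[OF cubic scaled_lipschitz_mult[OF this weak]]
  have quot: "scaled_lipschitz D 3
      (\<lambda>x y. lin c d x y * (lin 1 0 x y * lin 1 0 x y) * (1 / s x * (1 + lin 1 1 x y * lin 1 1 x y)))" for c d
    by simp
  have "field x y - (\<alpha> * \<beta> * x + (\<alpha> - \<beta>) * y) =
      lin (n * M) (- n) x y * (lin 1 1 x y * lin 1 1 x y)
      + lin (- (n * M * \<kappa> * (1 + (1 + r) * M))) (n * M * \<kappa> * r) x y
        * (lin 1 0 x y * lin 1 0 x y) * (1 / s x * (1 + lin 1 1 x y * lin 1 1 x y))" for x y
  proof -
    define Q where "Q = 1 + (x + y)\<^sup>2"
    have s0: "s x \<noteq> 0" using s_pos[of x] by simp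
    \<comment> \<open>Division with remainder by \<open>s\<close>: the quotient y - M x is the
      linear part of the bracket divided by n, and the remainder is cubic with a factor
      \<open>x\<^sup>2\<close>.\<close>
    have "(1 + M * (\<kappa> * x\<^sup>2)) * y - M * (1 - \<kappa> * x\<^sup>2) * x =
        (y - M * x) * s x + M * (\<kappa> * x\<^sup>2) * ((1 + (1 + r) * M) * x - r * y)"
      by (simp add: s_def algebra_simps)
    then have "((1 + M * (\<kappa> * x\<^sup>2)) * y - M * (1 - \<kappa> * x\<^sup>2) * x) / s x =
        (y - M * x) + M * (\<kappa> * x\<^sup>2) * ((1 + (1 + r) * M) * x - r * y) / s x"
      using s0 by (simp add: add_divide_distrib)
    moreover have "field x y = - y
        - n * (((1 + M * (\<kappa> * x\<^sup>2)) * y - M * (1 - \<kappa> * x\<^sup>2) * x) / s x) * Q"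
      by (simp add: field_def Q_def)
    ultimately have f: "field x y = - y - n * ((y - M * x) + M * (\<kappa> * x\<^sup>2) * ((1 + (1 + r) * M) * x - r * y) / s x) * Q"
      by simp
    have ab: "\<alpha> - \<beta> = - (n + 1)" by (simp add: \<beta>)
    have Q1: "1 + lin 1 1 x y * lin 1 1 x y = Q" "lin 1 1 x y * lin 1 1 x y = Q - 1"
      by (simp_all add: Q_def lin_def power2_eq_square)
    show ?thesis
      unfolding f \<alpha>\<beta> ab Q1 unfolding lin_def
      by (simp add: algebra_simps power2_eq_square diff_divide_distrib add_divide_distrib)
  qed
  then show ?thesis
    using scaled_lipschitz_add[OF cubic quot] by presburger
qed

section \<open>Estimates on and below the barrier\<close>

lemma below_gap:
  assumes "x > 0" "y > 0" "gap x y \<ge> 0"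
  shows "\<kappa> * x\<^sup>2 < 1" "x < x0" "y \<le> 2 * M * x" "x \<le> box" "y \<le> box"
proof -
  \<comment> \<open>A positive y under the barrier forces the barrier height to be positive, hence x
    < \<open>x0\<close>, where the height vanishes.\<close>
  have "(1 + M * (\<kappa> * x\<^sup>2)) * y > 0"
    using assms M \<kappa>_pos by (simp add: add_pos_nonneg)
  then have "0 < 2 * M * x * (1 - \<kappa> * x\<^sup>2)"
    using assms(3) unfolding gap_def by (simp add: mult_ac)
  then show w: "\<kappa> * x\<^sup>2 < 1"
    using M assms(1) zero_less_mult_pos[of "2 * M * x" "1 - \<kappa> * x\<^sup>2"] by simp
  then have "\<kappa> * x\<^sup>2 < \<kappa> * x0\<^sup>2" by (simp add: \<kappa>_x0)
  then have "x\<^sup>2 < x0\<^sup>2" using \<kappa>_pos by simp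
  then show x: "x < x0" using x0_pos by (simp add: power2_less_imp_less)
  have "y \<le> (1 + M * (\<kappa> * x\<^sup>2)) * y"
    using assms M \<kappa>_pos by (simp add: distrib_right)
  also have "\<dots> \<le> 2 * M * (1 - \<kappa> * x\<^sup>2) * x"
    using assms(3) unfolding gap_def by simp
  also have "\<dots> \<le> 2 * M * x"
    using M \<kappa>_pos assms(1) by (simp add: mult_left_le)
  finally show y: "y \<le> 2 * M * x" .
  have "M * x < M * x0" using x M by simp
  moreover have "0 < M * x0" using M x0_pos by simp
  ultimately show "x \<le> box" "y \<le> box"
    using x y x0_pos unfolding box_def by (auto simp: algebra_simps)
qed

text \<open>The terms with y are at worst - \<open>damping\<close> * y; the rest is a driving term
  that is positive for x < \<open>x0\<close>. The bound serves twice: it keeps \<psi> positive, and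
  it rules out a limit of \<phi> below \<open>x0\<close>.\<close>

lemma field_lower_bound:
  assumes "x > 0" "y > 0" "gap x y \<ge> 0"
  shows "field x y \<ge> n * M * (1 - \<kappa> * x\<^sup>2) * x / (1 + M * (1 + r)) - damping * y"
proof -
  define w where "w = \<kappa> * x\<^sup>2"
  define Q where "Q = 1 + (x + y)\<^sup>2"
  note below = below_gap[OF assms]
  have w: "0 \<le> w" "w < 1" using below(1) \<kappa>_pos by (auto simp: w_def)
  have Q1: "1 \<le> Q" by (simp add: Q_def)
  have "x + y \<le> box"
    using below(2,3) mult_strict_left_mono[OF below(2) M] by (simp add: box_def algebra_simps)
  then have Q2: "Q \<le> 1 + box\<^sup>2"
    using assms unfolding Q_def by (intro add_left_mono power_mono) auto
  have "s x = 1 + M * (1 + r) * w" by (simp add: s_def w_def)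
  also have "\<dots> \<le> 1 + M * (1 + r)"
    using w M r by (intro add_left_mono mult_left_le) auto
  finally have s: "s x \<le> 1 + M * (1 + r)" .
  have "n * (1 + M * w) * Q / s x * y \<le> n * (1 + M) * (1 + box\<^sup>2) * y"
  proof (rule mult_right_mono)
    have "n * (1 + M * w) * Q \<le> n * (1 + M) * (1 + box\<^sup>2)"
      using n M w Q1 Q2 by (intro mult_mono) (auto simp: mult_left_le)
    moreover have "n * (1 + M * w) * Q / s x \<le> n * (1 + M * w) * Q / 1"
      using n M w Q1 s_ge_1 s_pos by (intro divide_left_mono) auto
    ultimately show "n * (1 + M * w) * Q / s x \<le> n * (1 + M) * (1 + box\<^sup>2)" by simp
  qed (use assms in simp)
  moreover have "n * M * (1 - w) * x * 1 / (1 + M * (1 + r)) \<le> n * M * (1 - w) * x * Q / s x"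
    using n M w assms Q1 s s_pos by (intro frac_le mult_left_mono) auto
  moreover have "field x y = - y - n * (1 + M * w) * Q / s x * y + n * M * (1 - w) * x * Q / s x"
    unfolding field_def w_def[symmetric] Q_def[symmetric]
    by (simp add: algebra_simps diff_divide_distrib add_divide_distrib)
  ultimately show ?thesis
    unfolding w_def[symmetric] damping_def by (simp add: algebra_simps)
qed

text \<open>The quantity is the time derivative of \<open>gap\<close>, as in
  \<open>gap_derivative\<close>, at a point of the barrier. There y / x is a rational function of w,
  and clearing denominators leaves the polynomial of \<open>barrier\<close> at M w times positive
  factors.\<close>

lemma gap_increasing:
  assumes "x > 0" "y > 0" "gap x y = 0"
  shows "2 * M * (1 - 3 * (\<kappa> * x\<^sup>2)) * y - 2 * M * \<kappa> * x * y\<^sup>2 - (1 + M * (\<kappa> * x\<^sup>2)) * field x y > 0"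
proof -
  define w where "w = \<kappa> * x\<^sup>2"
  define d where "d = 1 + M * w"
  define v where "v = y / x"
  define Q where "Q = 1 + (x + y)\<^sup>2"
  \<comment> \<open>The right side minus the left side of \<open>barrier\<close> at M w, with d for
    1 + M w.\<close>
  define P where "P = n * d * (d\<^sup>2 * (M + 1) + r * (M * w) * (1 + 2 * M - M * w)\<^sup>2)
      + 2 * (M + 1) * d\<^sup>2 * (d + r * (M * w))
      - 4 * (M + 1) * (d + r * (M * w)) * ((M * w)\<^sup>2 + M * (M * w) + 3 * (M * w) - M)"
  have y: "y = x * v" using assms by (simp add: v_def)
  have w0: "w \<ge> 0" using \<kappa>_pos by (simp add: w_def)
  have d: "d > 0" using M w0 by (simp add: d_def add_pos_nonneg)
  have "x * (2 * M * (1 - w) - d * v) = 0"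
    using assms(3) by (simp add: gap_def w_def d_def y algebra_simps)
  then have dv: "d * v = 2 * M * (1 - w)" using assms(1) by simp
  have "d * v > 0" using d assms by (simp add: v_def)
  then have w1: "w < 1" using dv M by (simp add: zero_less_mult_iff)
  have x2: "(M + 1) * x\<^sup>2 = r * (M * w)"
    using M r by (simp add: w_def \<kappa>_def)
  have s: "s x = d + r * (M * w)" by (simp add: s_def w_def d_def algebra_simps)
  \<comment> \<open>On the zero curve this bracket would vanish; on the doubled curve the surplus M
    (1 - w) x remains.\<close>
  have field: "field x y = - y - n * M * (1 - w) * x * Q / s x"
  proof -
    have "d * y = x * (2 * M * (1 - w))"
      unfolding dv[symmetric] y by simp
    then have "d * y - M * (1 - w) * x = M * (1 - w) * x"
      by (simp add: algebra_simps)
    then show ?thesis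
      by (simp add: field_def w_def[symmetric] d_def[symmetric] Q_def[symmetric])
  qed
  have Q: "(M + 1) * (d\<^sup>2 * Q) = d\<^sup>2 * (M + 1) + r * (M * w) * (1 + 2 * M - M * w)\<^sup>2"
  proof -
    have "d\<^sup>2 * Q = d\<^sup>2 + x\<^sup>2 * (d + d * v)\<^sup>2"
      by (simp add: Q_def y power2_eq_square algebra_simps)
    moreover have "d + d * v = 1 + 2 * M - M * w"
      unfolding dv by (simp add: d_def algebra_simps)
    ultimately have "(M + 1) * (d\<^sup>2 * Q) = d\<^sup>2 * (M + 1) + (M + 1) * x\<^sup>2 * (1 + 2 * M - M * w)\<^sup>2"
      by (simp add: algebra_simps)
    then show ?thesis unfolding x2 .
  qed
  have P0: "P > 0"
    using barrier[of "M * w"] w0 w1 M by (simp add: P_def d_def)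
  \<comment> \<open>The derivative of \<open>gap\<close> divided by x. Multiplied by
    \<open>d\<^sup>2\<close> it contains v only through d v, which is known on the barrier, and the
    factor 1 - w splits off.\<close>
  define E where "E = 2 * M * (1 - 3 * w) * v - 2 * M * w * v\<^sup>2 + d * v + n * M * (1 - w) * d * Q / s x"
  have "d\<^sup>2 * E = M * (1 - w) * (4 * M * (1 - 3 * w) * d - 8 * M\<^sup>2 * w * (1 - w) + 2 * d\<^sup>2
      + n * d * (d\<^sup>2 * Q) / s x)"
  proof -
    have "d\<^sup>2 * E = 2 * M * (1 - 3 * w) * d * (d * v) - 2 * M * w * (d * v)\<^sup>2 + d\<^sup>2 * (d * v)
        + n * M * (1 - w) * d * (d\<^sup>2 * Q) / s x"
      by (simp add: E_def power2_eq_square algebra_simps)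
    also have "\<dots> = M * (1 - w) * (4 * M * (1 - 3 * w) * d - 8 * M\<^sup>2 * w * (1 - w) + 2 * d\<^sup>2
      + n * d * (d\<^sup>2 * Q) / s x)"
      unfolding dv by (simp add: power2_eq_square algebra_simps)
    finally show ?thesis .
  qed
  also have "4 * M * (1 - 3 * w) * d - 8 * M\<^sup>2 * w * (1 - w) + 2 * d\<^sup>2
      + n * d * (d\<^sup>2 * Q) / s x = P / ((M + 1) * s x)"
  proof -
    have "(M + 1) * s x * (4 * M * (1 - 3 * w) * d - 8 * M\<^sup>2 * w * (1 - w) + 2 * d\<^sup>2
      + n * d * (d\<^sup>2 * Q) / s x) = (M + 1) * s x * (4 * M * (1 - 3 * w) * d - 8 * M\<^sup>2 * w * (1 - w)
      + 2 * d\<^sup>2) + n * d * ((M + 1) * (d\<^sup>2 * Q))"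
      using s_pos[of x] by (simp add: field_simps)
    also have "\<dots> = P"
      unfolding Q unfolding P_def s d_def
      by (simp add: algebra_simps power2_eq_square)
    finally have eq: "(M + 1) * s x * (4 * M * (1 - 3 * w) * d - 8 * M\<^sup>2 * w * (1 - w) + 2 * d\<^sup>2
      + n * d * (d\<^sup>2 * Q) / s x) = P" .
    have "(M + 1) * s x \<noteq> 0"
      using s_pos[of x] M by simp
    then show ?thesis
      by (rule eq_divide_imp[OF _ trans[OF mult.commute eq]])
  qed
  finally have "d\<^sup>2 * E > 0"
    using P0 M w1 s_pos by simp
  then have "E > 0" using d by (simp add: zero_less_mult_iff)
  moreover have "2 * M * (1 - 3 * w) * y - 2 * M * \<kappa> * x * y\<^sup>2 - d * field x y = x * E"
    unfolding field unfolding E_def y by (simp add: w_def power2_eq_square algebra_simps)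
  ultimately show ?thesis
    using assms(1) by (simp add: w_def d_def)
qed

lemma gap_derivative:
  assumes "(\<phi> has_real_derivative \<psi> t) (at t)" "(\<psi> has_real_derivative u) (at t)"
  shows "((\<lambda>t. gap (\<phi> t) (\<psi> t)) has_real_derivative
    2 * M * (1 - 3 * (\<kappa> * (\<phi> t)\<^sup>2)) * \<psi> t - 2 * M * \<kappa> * \<phi> t * (\<psi> t)\<^sup>2 - (1 + M * (\<kappa> * (\<phi> t)\<^sup>2)) * u) (at t)"
  unfolding gap_def
  by (auto intro!: derivative_eq_intros assms simp: algebra_simps power2_eq_square)

section \<open>Trapping and convergence of the orbit\<close>

lemma gap_eventually_pos:
  assumes C: "\<And>t. t \<le> 0 \<Longrightarrow> \<bar>\<phi> t - exp (\<alpha> * t)\<bar> \<le> C * exp (2 * \<alpha> * t)"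
    "\<And>t. t \<le> 0 \<Longrightarrow> \<bar>\<psi> t - \<alpha> * exp (\<alpha> * t)\<bar> \<le> C * exp (2 * \<alpha> * t)"
  shows "\<forall>\<^sub>F t in at_bot. 0 < \<phi> t \<and> 0 < \<psi> t \<and> 0 < gap (\<phi> t) (\<psi> t)"
proof -
  have ratio: "((\<lambda>t. f t / exp (\<alpha> * t)) \<longlongrightarrow> c) at_bot"
    if f: "\<And>t. t \<le> 0 \<Longrightarrow> \<bar>f t - c * exp (\<alpha> * t)\<bar> \<le> C * exp (2 * \<alpha> * t)" for f c
  proof -
    have "((\<lambda>t. C * exp (\<alpha> * t)) \<longlongrightarrow> C * 0) at_bot"
      using \<alpha> by (intro tendsto_intros exp_mult_at_bot)
    moreover have "\<forall>\<^sub>F t in at_bot. norm (f t / exp (\<alpha> * t) - c) \<le> C * exp (\<alpha> * t)"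
    proof (rule eventually_mono[OF eventually_le_at_bot[of 0]])
      fix t :: real assume "t \<le> 0"
      have "f t / exp (\<alpha> * t) - c = (f t - c * exp (\<alpha> * t)) / exp (\<alpha> * t)"
        by (simp add: diff_divide_distrib)
      then have "norm (f t / exp (\<alpha> * t) - c) = \<bar>f t - c * exp (\<alpha> * t)\<bar> / exp (\<alpha> * t)"
        by simp
      also have "\<dots> \<le> C * exp (2 * \<alpha> * t) / exp (\<alpha> * t)"
        by (intro divide_right_mono f \<open>t \<le> 0\<close>) simp
      also have "\<dots> = C * exp (\<alpha> * t)"
        by (simp add: exp_half_square[symmetric] power2_eq_square)
      finally show "norm (f t / exp (\<alpha> * t) - c) \<le> C * exp (\<alpha> * t)" .
    qed
    ultimately have "((\<lambda>t. f t / exp (\<alpha> * t) - c) \<longlongrightarrow> 0) at_bot"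
      by (simp add: Lim_null_comparison)
    then show ?thesis by (rule LIM_zero_cancel)
  qed
  have \<phi>1: "((\<lambda>t. \<phi> t / exp (\<alpha> * t)) \<longlongrightarrow> 1) at_bot"
    by (rule ratio) (simp add: C(1))
  have \<psi>1: "((\<lambda>t. \<psi> t / exp (\<alpha> * t)) \<longlongrightarrow> \<alpha>) at_bot"
    by (rule ratio) (simp add: C(2))
  have \<phi>0: "(\<phi> \<longlongrightarrow> 0) at_bot"
    by (rule exp_asymptotic_tendsto_0[OF \<alpha>, of _ 1 C], simp only: mult_1 C)
  \<comment> \<open>All three quantities are of size exp (\<alpha> t); divided by it they tend to 1,
    \<alpha> and 2 M - \<alpha>, so their signs are settled near -\<infinity>.\<close>
  have "((\<lambda>t. 2 * M * (1 - \<kappa> * (\<phi> t)\<^sup>2) * (\<phi> t / exp (\<alpha> * t))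
      - (1 + M * (\<kappa> * (\<phi> t)\<^sup>2)) * (\<psi> t / exp (\<alpha> * t)))
      \<longlongrightarrow> 2 * M * (1 - \<kappa> * 0\<^sup>2) * 1 - (1 + M * (\<kappa> * 0\<^sup>2)) * \<alpha>) at_bot"
    by (intro tendsto_intros \<phi>0 \<phi>1 \<psi>1)
  also have "(\<lambda>t. 2 * M * (1 - \<kappa> * (\<phi> t)\<^sup>2) * (\<phi> t / exp (\<alpha> * t))
      - (1 + M * (\<kappa> * (\<phi> t)\<^sup>2)) * (\<psi> t / exp (\<alpha> * t))) = (\<lambda>t. gap (\<phi> t) (\<psi> t) / exp (\<alpha> * t))"
    by (simp add: gap_def diff_divide_distrib)
  finally have g: "((\<lambda>t. gap (\<phi> t) (\<psi> t) / exp (\<alpha> * t)) \<longlongrightarrow> 2 * M - \<alpha>) at_bot"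
    by simp
  have "2 * M - \<alpha> > 0" using \<alpha>_less_M M by simp
  from order_tendstoD(1)[OF \<phi>1 zero_less_one] order_tendstoD(1)[OF \<psi>1 \<alpha>] order_tendstoD(1)[OF g this]
  show ?thesis
    by eventually_elim (simp add: zero_less_divide_iff)
qed

text \<open>A first-exit argument: at the first bad time c none of the three inequalities can be the
  one that fails. The derivative u is tied to \<open>field\<close> only inside the box, because a
  priori the orbit solves the truncated equation.\<close>

lemma gap_stays_pos:
  assumes \<phi>: "\<And>t. (\<phi> has_real_derivative \<psi> t) (at t)"
    and \<psi>: "\<And>t. (\<psi> has_real_derivative u t) (at t)"
    and u: "\<And>t. \<bar>\<phi> t\<bar> \<le> box \<Longrightarrow> \<bar>\<psi> t\<bar> \<le> box \<Longrightarrow> u t = field (\<phi> t) (\<psi> t)"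
    and T: "\<And>t. t \<le> T \<Longrightarrow> 0 < \<phi> t \<and> 0 < \<psi> t \<and> 0 < gap (\<phi> t) (\<psi> t)"
  shows "0 < \<phi> t \<and> 0 < \<psi> t \<and> 0 < gap (\<phi> t) (\<psi> t)"
proof (rule ccontr)
  assume bad: "\<not> ?thesis"
  define G where "G = (\<lambda>t. gap (\<phi> t) (\<psi> t))"
  define S where "S = {t. \<phi> t \<le> 0 \<or> \<psi> t \<le> 0 \<or> G t \<le> 0}"
  have c\<phi>: "continuous_on UNIV \<phi>" and c\<psi>: "continuous_on UNIV \<psi>"
    by (rule has_real_derivative_continuous, rule \<phi>, rule has_real_derivative_continuous, rule \<psi>)
  then have cG: "continuous_on UNIV G"
    unfolding G_def gap_def by (intro continuous_intros)
  have "closed S"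
    unfolding S_def by (intro closed_Collect_disj closed_Collect_le continuous_on_const c\<phi> c\<psi> cG)
  moreover have "t \<in> S" using bad by (auto simp: S_def G_def not_less)
  moreover have bdd: "bdd_below S"
    using T by (intro bdd_belowI[of _ T]) (force simp: S_def G_def not_less[symmetric])
  ultimately have "Inf S \<in> S"
    by (intro closed_contains_Inf) auto
  define c where "c = Inf S"
  have cS: "c \<in> S" using \<open>Inf S \<in> S\<close> by (simp add: c_def)
  have good: "0 < \<phi> t" "0 < \<psi> t" "0 < G t" if "t < c" for t
  proof -
    have "t \<notin> S" using that cInf_lower[OF _ bdd, of t] by (force simp: c_def)
    then show "0 < \<phi> t" "0 < \<psi> t" "0 < G t" by (auto simp: S_def)
  qed
  have "\<phi> (c - 1) < \<phi> c"
  proof (rule DERIV_pos_imp_increasing_open[of "c - 1" c])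
    show "\<exists>y. (\<phi> has_real_derivative y) (at t) \<and> 0 < y" if "c - 1 < t" "t < c" for t
      using \<phi> good that by blast
  qed (use c\<phi> continuous_on_subset in auto)
  then have \<phi>c: "0 < \<phi> c" using good(1)[of "c - 1"] by simp
  have u_good: "u t = field (\<phi> t) (\<psi> t)" if "0 < \<phi> t" "0 < \<psi> t" "0 < G t" for t
    using below_gap(4,5)[OF that(1,2) less_imp_le[OF that(3)[unfolded G_def]]] that by (intro u) auto
  \<comment> \<open>\<psi> can decay at most exponentially below the barrier, so it does not reach 0
    at the finite time c.\<close>
  have "exp (damping * (c - 1)) * \<psi> (c - 1) \<le> exp (damping * c) * \<psi> c"
  proof (rule DERIV_nonneg_imp_increasing_open[of "c - 1" c])
    fix t assume t: "c - 1 < t" "t < c"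
    note g = good[OF t(2)]
    have "0 \<le> n * M * (1 - \<kappa> * (\<phi> t)\<^sup>2) * \<phi> t / (1 + M * (1 + r))"
      using below_gap(1)[OF g(1,2) less_imp_le[OF g(3)[unfolded G_def]]] g n M r by simp
    then have "0 \<le> damping * \<psi> t + u t"
      using field_lower_bound[OF g(1,2) less_imp_le[OF g(3)[unfolded G_def]]] u_good[OF g] by linarith
    moreover have "((\<lambda>t. exp (damping * t) * \<psi> t) has_real_derivative
        exp (damping * t) * (damping * \<psi> t + u t)) (at t)"
      by (auto intro!: derivative_eq_intros \<psi> simp: algebra_simps)
    ultimately show "\<exists>y. ((\<lambda>t. exp (damping * t) * \<psi> t) has_real_derivative y) (at t) \<and> 0 \<le> y"
      by (intro exI[of _ "exp (damping * t) * (damping * \<psi> t + u t)"]) simp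
  qed (use c\<psi> continuous_on_subset in \<open>auto intro!: continuous_intros\<close>)
  moreover have "0 < exp (damping * (c - 1)) * \<psi> (c - 1)"
    using good(2)[of "c - 1"] by simp
  ultimately have "0 < exp (damping * c) * \<psi> c" by linarith
  then have \<psi>c: "0 < \<psi> c" by (simp add: zero_less_mult_iff)
  have "isCont G c" using cG by (simp add: continuous_on_eq_continuous_at)
  then have "(G \<longlongrightarrow> G c) (at_left c)"
    by (simp add: isCont_def filterlim_at_split)
  moreover have "\<forall>\<^sub>F t in at_left c. 0 \<le> G t"
    by (rule eventually_at_leftI[of "c - 1"]) (auto dest: good(3))
  ultimately have "0 \<le> G c"
    by (intro tendsto_lowerbound) auto
  then have Gc: "G c = 0" using cS \<phi>c \<psi>c by (simp add: S_def)
  have "u c = field (\<phi> c) (\<psi> c)"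
    using below_gap(4,5)[OF \<phi>c \<psi>c] \<phi>c \<psi>c Gc by (intro u) (simp_all add: G_def)
  with gap_derivative[OF \<phi> \<psi>, of c] gap_increasing[OF \<phi>c \<psi>c] Gc
  obtain D where "(G has_real_derivative D) (at c)" "D > 0"
    unfolding G_def by force
  \<comment> \<open>A positive derivative at a zero of G would make G negative just before
    c.\<close>
  from DERIV_pos_inc_left[OF this] obtain e where e: "e > 0" "\<And>h. 0 < h \<Longrightarrow> h < e \<Longrightarrow> G (c - h) < G c"
    by blast
  from e(2)[of "e / 2"] e(1) good(3)[of "c - e / 2"] Gc
  show False by simp
qed

text \<open>The trapped region lies inside the box, so the truncation is never active along the
  orbit and the true field governs it throughout.\<close>

lemma trapped_orbit:
  obtains \<phi> \<psi> C where
    "\<And>t. (\<phi> has_real_derivative \<psi> t) (at t)"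
    and "\<And>t. (\<psi> has_real_derivative field (\<phi> t) (\<psi> t)) (at t)"
    and "\<And>t. 0 < \<phi> t" and "\<And>t. 0 < \<psi> t" and "\<And>t. 0 < gap (\<phi> t) (\<psi> t)"
    and "\<And>t. t \<le> 0 \<Longrightarrow> \<bar>\<phi> t - exp (\<alpha> * t)\<bar> \<le> C * exp (2 * \<alpha> * t)"
    and "\<And>t. t \<le> 0 \<Longrightarrow> \<bar>\<psi> t - \<alpha> * exp (\<alpha> * t)\<bar> \<le> C * exp (2 * \<alpha> * t)"
proof -
  define R where "R = (\<lambda>x y. field x y - (\<alpha> * \<beta> * x + (\<alpha> - \<beta>) * y))"
  obtain \<phi> \<psi> C where \<phi>: "\<And>t. (\<phi> has_real_derivative \<psi> t) (at t)"
    and \<psi>: "\<And>t. (\<psi> has_real_derivative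
      \<alpha> * \<beta> * \<phi> t + (\<alpha> - \<beta>) * \<psi> t + R (clip box (\<phi> t)) (clip box (\<psi> t))) (at t)"
    and C: "\<And>t. t \<le> 0 \<Longrightarrow> \<bar>\<phi> t - exp (\<alpha> * t)\<bar> \<le> C * exp (2 * \<alpha> * t)"
      "\<And>t. t \<le> 0 \<Longrightarrow> \<bar>\<psi> t - \<alpha> * exp (\<alpha> * t)\<bar> \<le> C * exp (2 * \<alpha> * t)"
    by (rule unstable_orbit[OF \<alpha> \<beta>_pos box_pos nonlinearity_cubic[folded R_def]], rule that)
  have u: "\<alpha> * \<beta> * \<phi> t + (\<alpha> - \<beta>) * \<psi> t + R (clip box (\<phi> t)) (clip box (\<psi> t)) = field (\<phi> t) (\<psi> t)"
    if "\<bar>\<phi> t\<bar> \<le> box" "\<bar>\<psi> t\<bar> \<le> box" for t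
    using that by (simp add: R_def clip_ident)
  obtain T where T: "\<And>t. t \<le> T \<Longrightarrow> 0 < \<phi> t \<and> 0 < \<psi> t \<and> 0 < gap (\<phi> t) (\<psi> t)"
    using gap_eventually_pos[OF C] by (auto simp: eventually_at_bot_linorder)
  have pos: "0 < \<phi> t" "0 < \<psi> t" "0 < gap (\<phi> t) (\<psi> t)" for t
    using gap_stays_pos[OF \<phi> \<psi> u T] by blast+
  have "\<bar>\<phi> t\<bar> \<le> box" "\<bar>\<psi> t\<bar> \<le> box" for t
    using below_gap(4,5)[OF pos(1,2) less_imp_le[OF pos(3)]] pos(1,2)[of t] by (simp_all add: less_imp_le)
  then have "(\<psi> has_real_derivative field (\<phi> t) (\<psi> t)) (at t)" for t
    using \<psi>[of t] u[of t] by simp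
  then show ?thesis
    using that[OF \<phi> _ pos C] by blast
qed

lemma trapped_orbit_limit:
  assumes \<phi>: "\<And>t. (\<phi> has_real_derivative \<psi> t) (at t)"
    and \<psi>: "\<And>t. (\<psi> has_real_derivative field (\<phi> t) (\<psi> t)) (at t)"
    and pos: "\<And>t. 0 < \<phi> t" "\<And>t. 0 < \<psi> t" "\<And>t. 0 < gap (\<phi> t) (\<psi> t)"
  shows "(\<phi> \<longlongrightarrow> x0) at_top" and "(\<psi> \<longlongrightarrow> 0) at_top"
proof -
  have mono: "\<phi> s \<le> \<phi> t" if "s \<le> t" for s t
    using that by (rule DERIV_nonneg_imp_nondecreasing) (use \<phi> pos(2) less_imp_le in blast)
  note below = below_gap[OF pos(1,2) less_imp_le[OF pos(3)]]
  have reach: "\<exists>t. a < \<phi> t" if a: "a < x0" for a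
  proof (rule ccontr)
    assume "\<not> (\<exists>t. a < \<phi> t)"
    then have le: "\<phi> t \<le> a" for t by (simp add: not_less)
    have a0: "0 < a" using le[of 0] pos(1)[of 0] by linarith
    have wa: "\<kappa> * a\<^sup>2 < 1"
      using \<kappa>_x0 \<kappa>_pos a a0 power_strict_mono[of a x0 2]
      by (metis less_imp_le mult_less_cancel_left_pos zero_less_numeral)
    \<comment> \<open>If \<phi> never exceeded a, then for t \<ge> 0 both \<phi> t \<ge> \<phi> 0
      and the bound by a would hold, and the driving term would be at least c.\<close>
    define c where "c = n * M * (1 - \<kappa> * a\<^sup>2) * \<phi> 0 / (1 + M * (1 + r))"
    have "1 + M * (1 + r) > 0" using M r by (simp add: add_pos_pos)
    then have c: "c > 0" using wa n M pos(1) by (simp add: c_def)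
    define H where "H = (\<lambda>t. \<psi> t + damping * \<phi> t - c * t)"
    have H': "(H has_real_derivative field (\<phi> t) (\<psi> t) + damping * \<psi> t - c) (at t)" for t
      unfolding H_def by (auto intro!: derivative_eq_intros \<phi> \<psi>)
    have "H 0 \<le> H t" if "0 \<le> t" for t
    proof (rule DERIV_nonneg_imp_nondecreasing[OF that])
      fix \<tau> :: real assume \<tau>: "0 \<le> \<tau>" "\<tau> \<le> t"
      have "\<kappa> * (\<phi> \<tau>)\<^sup>2 \<le> \<kappa> * a\<^sup>2"
        using \<kappa>_pos le pos(1) by (intro mult_left_mono power_mono) (auto simp: less_imp_le)
      then have "c \<le> n * M * (1 - \<kappa> * (\<phi> \<tau>)\<^sup>2) * \<phi> \<tau> / (1 + M * (1 + r))"
        unfolding c_def using wa n M \<open>1 + M * (1 + r) > 0\<close> mono[OF \<tau>(1)] pos(1)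
        by (intro divide_right_mono mult_mono) (auto simp: less_imp_le)
      also have "\<dots> \<le> field (\<phi> \<tau>) (\<psi> \<tau>) + damping * \<psi> \<tau>"
        using field_lower_bound[OF pos(1,2) less_imp_le[OF pos(3)], of \<tau>] by linarith
      finally show "\<exists>y. (H has_real_derivative y) (at \<tau>) \<and> 0 \<le> y"
        using H' by force
    qed
    moreover have "H t \<le> box + damping * box - c * t" for t
      using below(4,5)[of t] damping_pos unfolding H_def by (intro diff_right_mono add_mono mult_left_mono) auto
    ultimately have bd: "H 0 \<le> box + damping * box - c * t" if "0 \<le> t" for t
      using that order_trans by blast
    \<comment> \<open>At this time the upper bound for H has dropped to H 0 - 1 or less.\<close>
    define t where "t = max 0 ((box + damping * box - H 0 + 1) / c)"
    have "box + damping * box - H 0 + 1 \<le> c * t"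
      using c by (simp add: t_def max_def field_simps)
    then show False using bd[of t] by (simp add: t_def)
  qed
  show lim: "(\<phi> \<longlongrightarrow> x0) at_top"
  proof (rule order_tendstoI)
    fix a assume "a < x0"
    then obtain s where "a < \<phi> s" using reach by blast
    then show "\<forall>\<^sub>F t in at_top. a < \<phi> t"
      using mono by (auto simp: eventually_at_top_linorder intro: less_le_trans)
  next
    fix a assume "x0 < a"
    then show "\<forall>\<^sub>F t in at_top. \<phi> t < a"
      by (intro always_eventually allI less_trans[OF below(2)])
  qed
  \<comment> \<open>\<psi> is squeezed between 0 and a bound coming from the barrier, whose height
    vanishes as \<phi> tends to \<open>x0\<close>.\<close>
  have "((\<lambda>t. 2 * M * (1 - \<kappa> * (\<phi> t)\<^sup>2) * \<phi> t) \<longlongrightarrow> 2 * M * (1 - \<kappa> * x0\<^sup>2) * x0) at_top"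
    by (intro tendsto_intros lim)
  then have up: "((\<lambda>t. 2 * M * (1 - \<kappa> * (\<phi> t)\<^sup>2) * \<phi> t) \<longlongrightarrow> 0) at_top"
    by (simp add: \<kappa>_x0)
  have le: "\<psi> t \<le> 2 * M * (1 - \<kappa> * (\<phi> t)\<^sup>2) * \<phi> t" for t
  proof -
    have "\<psi> t \<le> (1 + M * (\<kappa> * (\<phi> t)\<^sup>2)) * \<psi> t"
      using pos(2)[of t] M \<kappa>_pos by (simp add: distrib_right)
    then show ?thesis using pos(3)[of t] by (simp add: gap_def)
  qed
  show "(\<psi> \<longlongrightarrow> 0) at_top"
    by (rule tendsto_sandwich[OF _ _ tendsto_const up])
      (use pos(2) le in \<open>auto intro!: always_eventually simp: less_imp_le\<close>)
qed

end

subsection \<open>Smoothness\<close>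

text \<open>Witnesses for the derivatives take the place of iterated \<open>deriv\<close>, so
  closure under products and inverses is a plain induction on the order, with no formula for higher
  derivatives.\<close>

primrec times_differentiable :: "nat \<Rightarrow> (real \<Rightarrow> real) \<Rightarrow> bool" where
  "times_differentiable 0 f \<longleftrightarrow> True"
| "times_differentiable (Suc m) f \<longleftrightarrow>
     (\<exists>f'. (\<forall>t. (f has_real_derivative f' t) (at t)) \<and> times_differentiable m f')"

lemma times_differentiable_Suc:
  "(\<And>t. (f has_real_derivative f' t) (at t)) \<Longrightarrow> times_differentiable m f' \<Longrightarrow> times_differentiable (Suc m) f"
  by auto

lemma times_differentiable_SucD: "times_differentiable (Suc m) f \<Longrightarrow> times_differentiable m f"
  by (induction m arbitrary: f) auto

lemma times_differentiable_const: "times_differentiable m (\<lambda>t. c)"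
proof (induction m arbitrary: c)
  case (Suc m)
  show ?case by (rule times_differentiable_Suc[OF DERIV_const Suc])
qed simp

lemma times_differentiable_add:
  "times_differentiable m f \<Longrightarrow> times_differentiable m g \<Longrightarrow> times_differentiable m (\<lambda>t. f t + g t)"
proof (induction m arbitrary: f g)
  case (Suc m)
  from Suc.prems obtain f' g' where
    "\<And>t. (f has_real_derivative f' t) (at t)" "times_differentiable m f'"
    "\<And>t. (g has_real_derivative g' t) (at t)" "times_differentiable m g'"
    by auto
  then show ?case by (intro times_differentiable_Suc[OF DERIV_add] Suc.IH)
qed simp

lemma times_differentiable_mult:
  "times_differentiable m f \<Longrightarrow> times_differentiable m g \<Longrightarrow> times_differentiable m (\<lambda>t. f t * g t)"
proof (induction m arbitrary: f g)
  case (Suc m)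
  from Suc.prems obtain f' g' where
    "\<And>t. (f has_real_derivative f' t) (at t)" "times_differentiable m f'"
    "\<And>t. (g has_real_derivative g' t) (at t)" "times_differentiable m g'"
    by auto
  with Suc.prems show ?case
    by (intro times_differentiable_Suc[OF DERIV_mult] times_differentiable_add Suc.IH
        times_differentiable_SucD[of m f] times_differentiable_SucD[of m g])
qed simp

lemma times_differentiable_inverse:
  "times_differentiable m f \<Longrightarrow> (\<And>t. f t \<noteq> 0) \<Longrightarrow> times_differentiable m (\<lambda>t. inverse (f t))"
proof (induction m arbitrary: f)
  case (Suc m)
  from Suc.prems obtain f' where f': "\<And>t. (f has_real_derivative f' t) (at t)" "times_differentiable m f'"
    by auto
  have "((\<lambda>t. inverse (f t)) has_real_derivative (- 1) * (f' t * (inverse (f t) * inverse (f t)))) (at t)" for t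
    using Suc.prems(2) by (auto intro!: derivative_eq_intros f'(1))
  moreover have "times_differentiable m (\<lambda>t. inverse (f t))"
    using Suc.prems by (intro Suc.IH times_differentiable_SucD[of m f])
  ultimately show ?case
    using f'(2) by (intro times_differentiable_Suc[OF _ times_differentiable_mult[OF times_differentiable_const
        times_differentiable_mult[OF f'(2) times_differentiable_mult]]])
qed simp

lemma smooth_realI:
  assumes "\<And>m. times_differentiable m f"
  shows "smooth_real f"
proof -
  have deriv: "times_differentiable m (deriv f)" if Suc: "times_differentiable (Suc m) f" for m f
  proof -
    obtain f' where f': "\<And>t. (f has_real_derivative f' t) (at t)" "times_differentiable m f'"
      using Suc by auto
    then have "deriv f = f'" by (auto intro: DERIV_imp_deriv)
    with f'(2) show ?thesis by simp
  qed
  have "times_differentiable j ((deriv ^^ m) f)" for j m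
    by (induction m arbitrary: j) (auto simp del: times_differentiable.simps intro: assms deriv)
  from this[of "Suc 0"] show ?thesis
    by (auto simp: smooth_real_def field_differentiable_def)
qed

text \<open>Bootstrapping: right-hand sides that are m times differentiable give solutions that are
  m + 1 times differentiable.\<close>

lemma smooth_orbit:
  assumes \<phi>: "\<And>t. (\<phi> has_real_derivative \<psi> t) (at t)"
    and \<psi>: "\<And>t. (\<psi> has_real_derivative F (\<phi> t) (\<psi> t)) (at t)"
    and F: "\<And>m. times_differentiable m \<phi> \<Longrightarrow> times_differentiable m \<psi> \<Longrightarrow>
      times_differentiable m (\<lambda>t. F (\<phi> t) (\<psi> t))"
  shows "smooth_real \<phi>" "smooth_real \<psi>"
proof -
  have "times_differentiable m \<phi> \<and> times_differentiable m \<psi>" for m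
  proof (induction m)
    case (Suc m)
    then show ?case
      using times_differentiable_Suc[OF \<phi>] times_differentiable_Suc[OF \<psi> F] by blast
  qed simp
  then show "smooth_real \<phi>" "smooth_real \<psi>" by (auto intro: smooth_realI)
qed

lemma lomse_field_smooth:
  assumes "times_differentiable m \<phi>" "times_differentiable m \<psi>"
  shows "times_differentiable m (\<lambda>t. lomse_field n p k (\<phi> t) (\<psi> t))"
proof -
  define L where "L = (lomse_lambda n p k)\<^sup>2"
  define q where "q = (\<lambda>t. inverse (1 + L * (\<phi> t * \<phi> t)))"
  have "1 + L * (\<phi> t * \<phi> t) > 0" for t
    by (simp add: L_def add_pos_nonneg)
  then have "times_differentiable m q"
    unfolding q_def
    by (intro times_differentiable_add times_differentiable_mult times_differentiable_const
        times_differentiable_inverse assms) (metis less_irrefl)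
  moreover have eq: "lomse_field n p k (\<phi> t) (\<psi> t) =
      (- 1) * \<psi> t + (- 1) * (((real n - real p + real p * q t) * \<psi> t +
        (real n - real p + (1 - L) * real p * q t) * \<phi> t) * (1 + (\<phi> t + \<psi> t) * (\<phi> t + \<psi> t)))" for t
    by (simp add: lomse_field_def Let_def L_def q_def divide_inverse power2_eq_square)
  ultimately show ?thesis
    unfolding eq
    by (intro times_differentiable_add times_differentiable_mult times_differentiable_const assms)
qed

subsection \<open>The polynomial inequality and the conclusion\<close>

text \<open>
  Substituting \<open>M = x + y\<close>, \<open>n = 7 + \<nu>\<close>, \<open>r = 1 + \<rho>\<close> turns the difference of the two sides into a
  polynomial with nonnegative coefficients.
\<close>
lemma barrier_large_dimension:
  fixes n M r x :: real
  assumes "n \<ge> 7" "r \<ge> 1" "0 \<le> x" "x < M"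
  shows "4 * (M + 1) * (1 + x + r * x) * (x\<^sup>2 + M * x + 3 * x - M) <
      n * (1 + x) * ((1 + x)\<^sup>2 * (M + 1) + r * x * (1 + 2 * M - x)\<^sup>2)
      + 2 * (M + 1) * (1 + x)\<^sup>2 * (1 + x + r * x)" (is "?L < ?R")
proof -
  define y where "y = M - x"
  define \<nu> where "\<nu> = n - 7"
  define \<rho> where "\<rho> = r - 1"
  have eqs: "M = x + y" "n = 7 + \<nu>" "r = 1 + \<rho>" by (auto simp: y_def \<nu>_def \<rho>_def)
  have nonneg: "y \<ge> 0" "\<nu> \<ge> 0" "\<rho> \<ge> 0" using assms by (auto simp: y_def \<nu>_def \<rho>_def)
  have "?R - ?L = \<nu> * (1 + x) * ((1 + x)\<^sup>2 * (x + y + 1) + (1 + \<rho>) * x * (1 + x + 2 * y)\<^sup>2)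
      + \<rho> * x * ((24 * x + 32) * y\<^sup>2 + (1 + x) * (18 * x + 34) * y + (1 + x)\<^sup>2 * (9 + x))
      + ((20 * x\<^sup>2 + 32 * x + 4) * y\<^sup>2 + (1 + x) * (15 * x\<^sup>2 + 44 * x + 13) * y
        + (1 + x)\<^sup>2 * (9 + 19 * x + 2 * x\<^sup>2))"
    unfolding eqs by (simp add: algebra_simps power2_eq_square)
  also have "\<dots> > 0"
    using nonneg \<open>0 \<le> x\<close>
    by (intro add_nonneg_pos add_nonneg_nonneg mult_nonneg_nonneg mult_pos_pos add_pos_nonneg) auto
  finally show ?thesis by simp
qed

text \<open>For n < 7 the number \<nu> above is negative, so the small types need certificates of
  their own. Here both sides agree at x = M, which explains the factor 5 / 3 - x; the inequality is
  strict only because x < M.\<close>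

lemma barrier_3_2_2:
  fixes x :: real
  assumes "0 \<le> x" "x < M" and M: "M = 5 / 3"
  shows "4 * (M + 1) * (1 + x + 2 * x) * (x\<^sup>2 + M * x + 3 * x - M) <
      3 * (1 + x) * ((1 + x)\<^sup>2 * (M + 1) + 2 * x * (1 + 2 * M - x)\<^sup>2)
      + 2 * (M + 1) * (1 + x)\<^sup>2 * (1 + x + 2 * x)" (is "?L < ?R")
proof -
  have "?R - ?L = (5 / 3 - x) * (56 / 3 + 334 / 3 * x + 34 * x\<^sup>2 + 6 * x\<^sup>2 * (5 / 3 - x))"
    unfolding M by (simp add: field_simps power2_eq_square)
  also have "\<dots> > 0"
    using assms by (intro mult_pos_pos add_pos_nonneg) auto
  finally show ?thesis by simp
qed

lemma barrier_5_4_2: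
  fixes x :: real
  assumes "0 \<le> x" "x < M" and M: "M = 7 / 5"
  shows "4 * (M + 1) * (1 + x + 4 * x) * (x\<^sup>2 + M * x + 3 * x - M) <
      5 * (1 + x) * ((1 + x)\<^sup>2 * (M + 1) + 4 * x * (1 + 2 * M - x)\<^sup>2)
      + 2 * (M + 1) * (1 + x)\<^sup>2 * (1 + x + 4 * x)" (is "?L < ?R")
proof -
  have "?R - ?L = 756 / 25 + 2528 / 25 * x + 24 / 5 * x\<^sup>2
      + 144 * x * (7 / 5 - x) * (7 / 5 + x) + 20 * x\<^sup>2 * x\<^sup>2"
    unfolding M by (simp add: field_simps power2_eq_square)
  also have "\<dots> > 0"
    using assms by (intro add_pos_nonneg mult_nonneg_nonneg) auto
  finally show ?thesis by simp
qed

lemma barrier_5_4_4: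
  fixes x :: real
  assumes "0 \<le> x" "x < M" and M: "M = 27 / 5"
  shows "4 * (M + 1) * (1 + x + 4 * x) * (x\<^sup>2 + M * x + 3 * x - M) <
      5 * (1 + x) * ((1 + x)\<^sup>2 * (M + 1) + 4 * x * (1 + 2 * M - x)\<^sup>2)
      + 2 * (M + 1) * (1 + x)\<^sup>2 * (1 + x + 4 * x)" (is "?L < ?R")
proof -
  \<comment> \<open>In the distance y to the endpoint, a square centred at y = 26 / 5 takes care of
    the terms of mixed sign.\<close>
  define y where "y = 27 / 5 - x"
  have x: "x = 27 / 5 - y" by (simp add: y_def)
  have "?R - ?L = 20 * y * (y - 26 / 5)\<^sup>2 * (y + 52 / 5) + 52 * y * (y - 26 / 5)\<^sup>2
      + x * (339 + 3648 / 5 * y) + (551 / 125 + 459 / 25 * y)"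
    unfolding M x by (simp add: field_simps power2_eq_square)
  also have "\<dots> > 0"
    using assms by (intro add_nonneg_pos add_nonneg_nonneg mult_nonneg_nonneg add_pos_nonneg) (auto simp: y_def)
  finally show ?thesis by simp
qed

lemma lomse_type_bounds:
  assumes "lomse_type n p k"
  shows "0 < p" "p < n" "2 \<le> k" "7 \<le> n \<Longrightarrow> n \<le> 2 * p"
  using assms unfolding lomse_type_def by (auto elim!: evenE)

text \<open>The list of types enters here. At x = M the two sides differ by a positive multiple of
  (n + 2) (M + 1) - 8 M. This is positive for every M when n \<ge> 7; for n = 5 it is negative from
  k = 6 on, and for n = 3 it vanishes at k = 2 and is negative from k = 4 on.\<close>

lemma lomse_barrier:
  fixes x :: real
  assumes "lomse_type n p k"
    and "(n, p, k) = (3, 2, 2) \<or> (n, p, k) = (5, 4, 2) \<or> (n, p, k) = (5, 4, 4) \<or> n \<ge> 7"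
    and M: "M = (real k - 1) * (real n + real k) / real n"
    and r: "r = real p / (real n - real p)"
    and x: "0 \<le> x" "x < M"
  shows "4 * (M + 1) * (1 + x + r * x) * (x\<^sup>2 + M * x + 3 * x - M) <
      real n * (1 + x) * ((1 + x)\<^sup>2 * (M + 1) + r * x * (1 + 2 * M - x)\<^sup>2)
      + 2 * (M + 1) * (1 + x)\<^sup>2 * (1 + x + r * x)"
  using assms(2)
proof (elim disjE)
  assume "(n, p, k) = (3, 2, 2)"
  then have eqs: "real n = 3" "r = 2" "M = 5 / 3"
    by (simp_all add: M r)
  show ?thesis
    unfolding eqs(1,2) by (rule barrier_3_2_2[OF x eqs(3)])
next
  assume "(n, p, k) = (5, 4, 2)"
  then have eqs: "real n = 5" "r = 4" "M = 7 / 5"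
    by (simp_all add: M r)
  show ?thesis
    unfolding eqs(1,2) by (rule barrier_5_4_2[OF x eqs(3)])
next
  assume "(n, p, k) = (5, 4, 4)"
  then have eqs: "real n = 5" "r = 4" "M = 27 / 5"
    by (simp_all add: M r)
  show ?thesis
    unfolding eqs(1,2) by (rule barrier_5_4_4[OF x eqs(3)])
next
  assume "n \<ge> 7"
  then have "real n \<ge> 7" "real n \<le> 2 * real p" "real p < real n"
    using lomse_type_bounds[OF assms(1)] by (simp_all flip: of_nat_mult of_nat_le_iff)
  then show ?thesis
    \<comment> \<open>n \<le> 2 p is the condition r \<ge> 1.\<close>
    using x by (intro barrier_large_dimension) (auto simp: r le_divide_eq)
qed

lemma exp_asymptotic_bigo:
  fixes f :: "real \<Rightarrow> real"
  assumes "\<alpha> > 0" and f: "\<And>t. t \<le> 0 \<Longrightarrow> \<bar>f t - c * exp (\<alpha> * t)\<bar> \<le> C * exp (2 * \<alpha> * t)"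
  shows "f \<in> O[at_bot](\<lambda>t. exp (\<alpha> * t))"
proof (rule bigoI[of _ "\<bar>c\<bar> + \<bar>C\<bar>"], rule eventually_mono[OF eventually_le_at_bot[of 0]])
  fix t :: real assume t: "t \<le> 0"
  have "exp (2 * \<alpha> * t) \<le> exp (\<alpha> * t)"
    using t \<open>\<alpha> > 0\<close> by (simp add: mult_nonneg_nonpos)
  then have "C * exp (2 * \<alpha> * t) \<le> \<bar>C\<bar> * exp (\<alpha> * t)"
    by (intro mult_mono) auto
  moreover have "\<bar>f t\<bar> \<le> \<bar>c * exp (\<alpha> * t)\<bar> + \<bar>f t - c * exp (\<alpha> * t)\<bar>"
    by linarith
  ultimately show "norm (f t) \<le> (\<bar>c\<bar> + \<bar>C\<bar>) * norm (exp (\<alpha> * t))"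
    using f[OF t] by (simp add: abs_mult distrib_right)
qed

theorem proposition3p3:
  fixes n p k :: nat
  assumes "lomse_type n p k"
    and "(n, p, k) = (3, 2, 2) \<or> (n, p, k) = (5, 4, 2) \<or> (n, p, k) = (5, 4, 4) \<or> n \<ge> 7"
  shows "\<exists>\<phi> \<psi> :: real \<Rightarrow> real.
           smooth_real \<phi> \<and> smooth_real \<psi> \<and> lomse_solution n p k \<phi> \<psi> \<and>
           ((\<lambda>t. (\<phi> t, \<psi> t)) \<longlongrightarrow> (0, 0)) at_bot \<and>
           \<phi> \<in> O[at_bot](\<lambda>t. exp ((real k - 1) * t)) \<and>
           \<psi> \<in> O[at_bot](\<lambda>t. exp ((real k - 1) * t)) \<and>
           ((\<lambda>t. (\<phi> t, \<psi> t)) \<longlongrightarrow> (lomse_phi0 n p k, 0)) at_top \<and>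
           strict_mono \<phi> \<and>
           (\<forall>t. \<psi> t > 0)"
proof -
  define \<alpha> where "\<alpha> = real k - 1"
  define \<beta> where "\<beta> = real n + real k"
  define M where "M = \<alpha> * \<beta> / real n"
  define r where "r = real p / (real n - real p)"
  define L where "L = (lomse_lambda n p k)\<^sup>2"
  have pn: "0 < real p" "real p < real n" "2 \<le> real k"
    using lomse_type_bounds[OF assms(1)] by auto
  have pos: "\<alpha> > 0" "\<beta> > 0" "M > 0" "r > 0"
    using pn by (auto simp: \<alpha>_def \<beta>_def M_def r_def)
  interpret node_field "real n" M r \<alpha> \<beta>
  proof
    show "\<beta> = \<alpha> + real n + 1" by (simp add: \<alpha>_def \<beta>_def)
    show "\<alpha> * \<beta> = real n * M" using pn by (simp add: M_def)
  qed (use pn pos lomse_barrier[OF assms, of M r] in \<open>simp_all add: M_def r_def \<alpha>_def \<beta>_def\<close>)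
  have "L = real k * (real k + real n - 1) / real p"
    using pn unfolding L_def lomse_lambda_def by (intro real_sqrt_pow2) auto
  moreover have M1: "real n * (M + 1) = real k * (real k + real n - 1)"
    using pn by (simp add: M_def \<alpha>_def \<beta>_def field_simps)
  ultimately have Lp: "L * real p = real n * (M + 1)"
    using pn by simp
  have pr: "real p = r * (real n - real p)" "real n = (1 + r) * (real n - real p)"
    using pn by (simp_all add: r_def field_simps)
  have nL: "(real n - real p) * L = real n * M * \<kappa>"
  proof -
    have "r * ((real n - real p) * L) = L * real p"
      using pr(1) by simp
    also have "\<dots> = r * (real n * M * \<kappa>)"
      unfolding Lp using pos by (simp add: \<kappa>_def)
    finally have "r * ((real n - real p) * L) = r * (real n * M * \<kappa>)" .
    then show ?thesis using pos by simp
  qed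
  have L: "L = M * (1 + r) * \<kappa>"
  proof -
    have "(real n - real p) * L = (real n - real p) * (M * (1 + r) * \<kappa>)"
      using nL pr(2) by (simp add: mult_ac)
    then show ?thesis using pn by simp
  qed
  have field: "lomse_field n p k x y = field x y" for x y
  proof -
    define S where "S = 1 + L * x\<^sup>2"
    have S: "s x = S" by (simp add: S_def s_def L)
    have S0: "S \<noteq> 0" using s_pos[of x] by (simp add: S)
    have "(real n - real p) * S + real p = real n * (1 + M * (\<kappa> * x\<^sup>2))"
      \<comment> \<open>Over the denominator S the coefficient of y has the numerator n (1 + M w),
        and below that of x has - n M (1 - w), with \<open>w = \<kappa> * x\<^sup>2\<close>.\<close>
      using nL unfolding S_def by (simp add: distrib_left mult.assoc[symmetric])
    then have a: "real n - real p + real p / S = real n * (1 + M * (\<kappa> * x\<^sup>2)) / S"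
      using S0 by (simp add: field_simps)
    have "(real n - real p) * S + (1 - L) * real p = - (real n * (M * (1 - \<kappa> * x\<^sup>2)))"
    proof -
      have "(real n - real p) * (L * x\<^sup>2) = real n * M * \<kappa> * x\<^sup>2"
        unfolding mult.assoc[symmetric] nL ..
      moreover have "(1 - L) * real p = real p - real n * (M + 1)"
        by (simp add: left_diff_distrib Lp)
      ultimately show ?thesis
        unfolding S_def distrib_left by (simp add: algebra_simps)
    qed
    then have b: "real n - real p + (1 - L) * real p / S = - (real n * (M * (1 - \<kappa> * x\<^sup>2))) / S"
      using S0 by (simp add: field_simps)
    show ?thesis
      unfolding lomse_field_def Let_def L_def[symmetric] S_def[symmetric] field_def S a b
      by (simp add: algebra_simps diff_divide_distrib add_divide_distrib)
  qed
  have phi0: "lomse_phi0 n p k = x0"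
  proof -
    have L0: "L > 0" using Lp pn pos by (metis zero_less_mult_iff add_pos_pos zero_less_one less_trans less_asym)
    have "(real p - real n * inverse L) / (real n - real p) = (L * real p - real n) / ((real n - real p) * L)"
      using L0 pn by (simp add: field_simps)
    also have "\<dots> = 1 / \<kappa>"
      unfolding Lp nL using pn pos \<kappa>_pos by (simp add: field_simps)
    finally show ?thesis
      unfolding lomse_phi0_def x0_def L_def[symmetric] by simp
  qed
  obtain \<phi> \<psi> C where \<phi>: "\<And>t. (\<phi> has_real_derivative \<psi> t) (at t)"
    and \<psi>: "\<And>t. (\<psi> has_real_derivative field (\<phi> t) (\<psi> t)) (at t)"
    and good: "\<And>t. 0 < \<phi> t" "\<And>t. 0 < \<psi> t" "\<And>t. 0 < gap (\<phi> t) (\<psi> t)"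
    and C: "\<And>t. t \<le> 0 \<Longrightarrow> \<bar>\<phi> t - exp (\<alpha> * t)\<bar> \<le> C * exp (2 * \<alpha> * t)"
      "\<And>t. t \<le> 0 \<Longrightarrow> \<bar>\<psi> t - \<alpha> * exp (\<alpha> * t)\<bar> \<le> C * exp (2 * \<alpha> * t)"
    by (rule trapped_orbit, rule that)
  have C1: "\<bar>\<phi> t - 1 * exp (\<alpha> * t)\<bar> \<le> C * exp (2 * \<alpha> * t)" if "t \<le> 0" for t
    using C(1)[OF that] by simp
  have \<psi>': "(\<psi> has_real_derivative lomse_field n p k (\<phi> t) (\<psi> t)) (at t)" for t
    using \<psi> by (simp add: field)
  show ?thesis
  proof (rule exI[of _ \<phi>], rule exI[of _ \<psi>], intro conjI allI)
    show "smooth_real \<phi>" "smooth_real \<psi>"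
      using smooth_orbit[OF \<phi> \<psi>' lomse_field_smooth] by blast+
    show "lomse_solution n p k \<phi> \<psi>"
      using \<phi> \<psi>' by (simp add: lomse_solution_def)
    show "((\<lambda>t. (\<phi> t, \<psi> t)) \<longlongrightarrow> (0, 0)) at_bot"
      by (intro tendsto_Pair exp_asymptotic_tendsto_0[OF pos(1) C1] exp_asymptotic_tendsto_0[OF pos(1) C(2)])
    show "\<phi> \<in> O[at_bot](\<lambda>t. exp ((real k - 1) * t))" "\<psi> \<in> O[at_bot](\<lambda>t. exp ((real k - 1) * t))"
      unfolding \<alpha>_def[symmetric]
      by (rule exp_asymptotic_bigo[OF pos(1) C1], assumption)
        (rule exp_asymptotic_bigo[OF pos(1) C(2)])
    show "((\<lambda>t. (\<phi> t, \<psi> t)) \<longlongrightarrow> (lomse_phi0 n p k, 0)) at_top"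
      unfolding phi0 by (intro tendsto_Pair trapped_orbit_limit[OF \<phi> \<psi> good])
    show "strict_mono \<phi>"
      by (rule strict_monoI, rule DERIV_pos_imp_increasing) (use \<phi> good(2) in blast)+
    show "\<psi> t > 0" for t by (rule good)
  qed
qed

end
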